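(* For every integer $r\geq3$, the Dehn function of the group $G_{2,r}=p_{2,\dots,r}(H_r)\leq F_2^{(2)}\times\dots\times F_2^{(r)}$ satisfies $\delta_{G_{2,r}}(n)\succcurlyeq n^{r-1}$.
   Context: For a group $G$, $\gamma_c(G)$ denotes the $c$-th term of the lower central series: $\gamma_1(G)=G$, $\gamma_{c+1}(G)=[G,\gamma_c(G)]$. Definition of $H_r$ and $G_{2,r}$. For $r\geq3$ let $F_2^{(i)}$ be the free group on $\{a_i,b_i\}$, $1\leq i\leq r$. For each $i$ choose a finite set $Y_i\subset F_2^{(i)}$ whose normal closure in $F_2^{(i)}$ is $\gamma_{r-1}(F_2^{(i)})$; regard $F_2^{(i)}$ (and hence $Y_i$) as contained in the $i$-th factor of $F_2^{(1)}\times\dots\times F_2^{(r)}$. Set $z_{1,r}=(a_1,a_2,\dots,a_r)$, $z_{2,r}=(b_1,b_2,\dots,b_r)$, $z_{3,r}=(a_1,a_2^2,\dots,a_r^r)$, $z_{4,r}=(b_1,b_2^2,\dots,b_r^r)$. Let $H_r\leq F_2^{(1)}\times\dots\times F_2^{(r)}$ be the subgroup generated by $Y_1\cup\dots\cup Y_r\cup\{z_{1,r},z_{2,r},z_{3,r},z_{4,r}\}$. Let $p_{2,\dots,r}:F_2^{(1)}\times\dots\times F_2^{(r)}\to F_2^{(2)}\times\dots\times F_2^{(r)}$ be the canonical projection and $G_{2,r}=p_{2,\dots,r}(H_r)$. The group $G_{2,r}$ is finitely presented (a consequence of results of Bridson, Howie, Miller and Short), so its Dehn function is defined. Dehn functions.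 For a finitely presented group $G$ with finite presentation $\mathcal{P}=\langle X\mid R\rangle$, a word $w$ in $X^{\pm1}$ is null-homotopic if it represents $1\in G$. Its area $\mathrm{Area}_{\mathcal{P}}(w)$ is the minimal $k$ such that $w$ is equal in the free group on $X$ to a product $\prod_{i=1}^k\theta_i r_i\theta_i^{-1}$ with $r_i\in R^{\pm1}$ and $\theta_i$ words in $X^{\pm 1}$. The Dehn function is $\delta_G(n)=\max\{\mathrm{Area}_{\mathcal{P}}(w)\mid w \text{ null-homotopic of word length}\leq n\}$. For non-decreasing functions $f,g:\mathbb{N}\to\mathbb{R}_{\geq0}$ write $f\preccurlyeq g$ (equivalently $g\succcurlyeq f$) if there is a constant $C\geq1$ such that $f(n)\leq Cg(Cn)+Cn+C$ for all $n\in\mathbb{N}$. Up to the resulting equivalence, $\delta_G$ does not depend on the choice of finite presentation. *)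

theory Defs
  imports Complex_Main "HOL-Algebra.Product_Groups"
begin

section \<open>Words and free groups\<close>

text \<open>The letter \<open>(x, True)\<close> stands for \<open>x\<close> and \<open>(x, False)\<close> for the inverse of \<open>x\<close>.\<close>

type_synonym 'x word = "('x \<times> bool) list"

definition words :: "'x set \<Rightarrow> 'x word set" where
  "words X = lists (X \<times> UNIV)"

definition letter_inv :: "'x \<times> bool \<Rightarrow> 'x \<times> bool" where
  "letter_inv l = (fst l, \<not> snd l)"

definition word_inv :: "'x word \<Rightarrow> 'x word" where
  "word_inv w = rev (map letter_inv w)"

definition reduced :: "'x word \<Rightarrow> bool" where
  "reduced w \<longleftrightarrow> successively (\<lambda>l m. m \<noteq> letter_inv l) w"

fun cancel_Cons :: "'x \<times> bool \<Rightarrow> 'x word \<Rightarrow> 'x word" where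
  "cancel_Cons l [] = [l]"
| "cancel_Cons l (m # w) = (if m = letter_inv l then w else l # m # w)"

text \<open>The free reduction of a word; two words are equal in the free group iff they have the same
  free reduction.\<close>

definition free_reduce :: "'x word \<Rightarrow> 'x word" where
  "free_reduce w = foldr cancel_Cons w []"

definition free_group :: "'x set \<Rightarrow> 'x word monoid" where
  "free_group X =
     \<lparr>carrier = {w \<in> words X. reduced w}, mult = (\<lambda>u v. free_reduce (u @ v)), one = []\<rparr>"

lemma letter_inv_letter_inv [simp]: "letter_inv (letter_inv l) = l"
  by (simp add: letter_inv_def)

lemma letter_inv_neq [simp]: "letter_inv l \<noteq> l"
  by (cases l) (simp add: letter_inv_def)

lemma reduced_Nil: "reduced []"
  by (simp add: reduced_def)

lemma reduced_cancel_Cons: "reduced w \<Longrightarrow> reduced (cancel_Cons l w)"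
  by (cases w) (auto simp: reduced_def successively_Cons)

lemma reduced_foldr: "reduced v \<Longrightarrow> reduced (foldr cancel_Cons u v)"
  by (induction u) (auto intro: reduced_cancel_Cons)

lemma reduced_free_reduce: "reduced (free_reduce w)"
  unfolding free_reduce_def by (rule reduced_foldr) (simp add: reduced_def)

lemma free_reduce_reduced: "reduced w \<Longrightarrow> free_reduce w = w"
  unfolding free_reduce_def reduced_def
proof (induction w)
  case (Cons l w)
  then show ?case by (cases w) (auto simp: successively_Cons)
qed simp

lemma cancel_Cons_inverse:
  assumes "reduced w"
  shows "cancel_Cons l (cancel_Cons (letter_inv l) w) = w"
proof (cases w)
  case (Cons m v)
  with assms show ?thesis by (cases v) (auto simp: reduced_def)
qed simp

lemma foldr_cancel_Cons:
  assumes "reduced w"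
  shows "foldr cancel_Cons (cancel_Cons l u) w = cancel_Cons l (foldr cancel_Cons u w)"
proof (cases u)
  case (Cons m v)
  show ?thesis
  proof (cases "m = letter_inv l")
    case True
    then show ?thesis
      using Cons cancel_Cons_inverse[OF reduced_foldr[OF assms]] by simp
  qed (simp add: Cons)
qed simp

lemma foldr_free_reduce:
  "reduced w \<Longrightarrow> foldr cancel_Cons (free_reduce u) w = foldr cancel_Cons u w"
  by (induction u) (simp_all add: free_reduce_def foldr_cancel_Cons)

lemma free_reduce_append_left: "free_reduce (free_reduce u @ v) = free_reduce (u @ v)"
  using foldr_free_reduce[OF reduced_free_reduce, of u v] by (simp add: free_reduce_def)

lemma free_reduce_append_right: "free_reduce (u @ free_reduce v) = free_reduce (u @ v)"
  using free_reduce_reduced[OF reduced_free_reduce, of v] by (simp add: free_reduce_def)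

lemma free_reduce_word_inv_append: "free_reduce (word_inv w @ w) = []"
proof (induction w)
  case (Cons l w)
  have "free_reduce (l # w) = cancel_Cons l (free_reduce w)"
    by (simp add: free_reduce_def)
  then have "free_reduce (word_inv (l # w) @ l # w)
      = foldr cancel_Cons (word_inv w) (cancel_Cons (letter_inv l) (cancel_Cons l (free_reduce w)))"
    by (simp add: word_inv_def free_reduce_def)
  also have "\<dots> = foldr cancel_Cons (word_inv w) (free_reduce w)"
    using cancel_Cons_inverse[OF reduced_free_reduce, of "letter_inv l" w] by simp
  finally show ?case using Cons.IH by (simp add: free_reduce_def)
qed (simp add: word_inv_def free_reduce_def)

lemma Nil_words: "[] \<in> words X"
  by (simp add: words_def)

lemma words_append: "u \<in> words X \<Longrightarrow> v \<in> words X \<Longrightarrow> u @ v \<in> words X"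
  by (simp add: words_def)

lemma words_word_inv: "w \<in> words X \<Longrightarrow> word_inv w \<in> words X"
  by (auto simp: words_def word_inv_def letter_inv_def in_lists_conv_set)

lemma words_cancel_Cons: "l \<in> X \<times> UNIV \<Longrightarrow> w \<in> words X \<Longrightarrow> cancel_Cons l w \<in> words X"
  by (cases w) (auto simp: words_def)

lemma words_free_reduce: "w \<in> words X \<Longrightarrow> free_reduce w \<in> words X"
proof (induction w)
  case (Cons l w)
  then have "l \<in> X \<times> UNIV" "free_reduce w \<in> words X"
    by (auto simp: words_def)
  from words_cancel_Cons[OF this] show ?case
    by (simp add: free_reduce_def)
qed (simp add: words_def free_reduce_def)

lemma group_free_group: "group (free_group X)"
proof (rule groupI)
  fix w assume w: "w \<in> carrier (free_group X)"
  have "free_reduce (word_inv w) \<otimes>\<^bsub>free_group X\<^esub> w = \<one>\<^bsub>free_group X\<^esub>"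
    by (simp add: free_group_def free_reduce_append_left free_reduce_word_inv_append)
  moreover have "free_reduce (word_inv w) \<in> carrier (free_group X)"
    using w by (simp add: free_group_def words_free_reduce words_word_inv reduced_free_reduce)
  ultimately show "\<exists>v\<in>carrier (free_group X). v \<otimes>\<^bsub>free_group X\<^esub> w = \<one>\<^bsub>free_group X\<^esub>"
    by blast
qed (auto simp: free_group_def free_reduce_append_left free_reduce_append_right
    free_reduce_reduced reduced_free_reduce words_free_reduce words_append Nil_words reduced_Nil)


section \<open>Normal closures and the lower central series\<close>

definition normal_closure :: "('a, 'm) monoid_scheme \<Rightarrow> 'a set \<Rightarrow> 'a set" where
  "normal_closure G S = \<Inter>{N. N \<lhd> G \<and> S \<subseteq> N}"

definition commutator_subgroup :: "('a, 'm) monoid_scheme \<Rightarrow> 'a set \<Rightarrow> 'a set \<Rightarrow> 'a set" where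
  "commutator_subgroup G H K =
     generate G {h \<otimes>\<^bsub>G\<^esub> k \<otimes>\<^bsub>G\<^esub> inv\<^bsub>G\<^esub> h \<otimes>\<^bsub>G\<^esub> inv\<^bsub>G\<^esub> k | h k. h \<in> H \<and> k \<in> K}"

text \<open>The series is indexed from 1; the value at 0 is a dummy.\<close>

fun lower_central :: "('a, 'm) monoid_scheme \<Rightarrow> nat \<Rightarrow> 'a set" where
  "lower_central G 0 = carrier G"
| "lower_central G (Suc 0) = carrier G"
| "lower_central G (Suc (Suc c)) =
     commutator_subgroup G (carrier G) (lower_central G (Suc c))"


section \<open>Finite presentations and Dehn functions\<close>

definition word_eval :: "('a, 'm) monoid_scheme \<Rightarrow> ('x \<Rightarrow> 'a) \<Rightarrow> 'x word \<Rightarrow> 'a" where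
  "word_eval G \<phi> w =
     foldr (\<lambda>(x, s) g. (if s then \<phi> x else inv\<^bsub>G\<^esub> (\<phi> x)) \<otimes>\<^bsub>G\<^esub> g) w \<one>\<^bsub>G\<^esub>"

text \<open>\<open>\<langle>X | R\<rangle>\<close> is a finite presentation of \<open>G\<close> in which the generator \<open>x \<in> X\<close> represents the
  element \<open>\<phi> x\<close>; the map \<open>\<phi>\<close> need not be injective. Relators need not be reduced words.\<close>

definition finite_presentation ::
  "('a, 'm) monoid_scheme \<Rightarrow> 'x set \<Rightarrow> 'x word set \<Rightarrow> ('x \<Rightarrow> 'a) \<Rightarrow> bool" where
  "finite_presentation G X R \<phi> \<longleftrightarrow>
     group G \<and> finite X \<and> finite R \<and> R \<subseteq> words X \<and> \<phi> \<in> X \<rightarrow> carrier G \<and>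
     word_eval G \<phi> \<in> epi (free_group X) G \<and>
     kernel (free_group X) G (word_eval G \<phi>) = normal_closure (free_group X) (free_reduce ` R)"

definition null_homotopic ::
  "('a, 'm) monoid_scheme \<Rightarrow> 'x set \<Rightarrow> ('x \<Rightarrow> 'a) \<Rightarrow> 'x word \<Rightarrow> bool" where
  "null_homotopic G X \<phi> w \<longleftrightarrow> w \<in> words X \<and> word_eval G \<phi> w = \<one>\<^bsub>G\<^esub>"

definition area :: "'x set \<Rightarrow> 'x word set \<Rightarrow> 'x word \<Rightarrow> nat" where
  "area X R w = (LEAST k. \<exists>cs. length cs = k \<and> set cs \<subseteq> words X \<times> (R \<union> word_inv ` R) \<and>
     free_reduce w = free_reduce (concat (map (\<lambda>(\<theta>, \<rho>). \<theta> @ \<rho> @ word_inv \<theta>) cs)))"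

definition dehn_function ::
  "('a, 'm) monoid_scheme \<Rightarrow> 'x set \<Rightarrow> 'x word set \<Rightarrow> ('x \<Rightarrow> 'a) \<Rightarrow> nat \<Rightarrow> nat" where
  "dehn_function G X R \<phi> n =
     Max (area X R ` {w. null_homotopic G X \<phi> w \<and> length w \<le> n})"

definition dehn_preceq :: "(nat \<Rightarrow> real) \<Rightarrow> (nat \<Rightarrow> real) \<Rightarrow> bool" (infix \<open>\<preceq>\<^sub>D\<close> 50) where
  "f \<preceq>\<^sub>D g \<longleftrightarrow>
     (\<exists>C::nat. C \<ge> 1 \<and> (\<forall>n. f n \<le> real C * g (C * n) + real C * real n + real C))"


section \<open>The groups \<open>H\<^sub>r\<close> and \<open>G\<^sub>2\<^sub>,\<^sub>r\<close>\<close>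

datatype gen = Gen_a | Gen_b

text \<open>Every factor \<open>F\<^sub>2\<^sup>(\<^sup>i\<^sup>)\<close> is this same group; the factors of the product are told apart
  by the coordinate.\<close>

abbreviation F2 :: "gen word monoid" where
  "F2 \<equiv> free_group {Gen_a, Gen_b}"

definition F2_a :: "gen word" where "F2_a = [(Gen_a, True)]"
definition F2_b :: "gen word" where "F2_b = [(Gen_b, True)]"

abbreviation F2_product :: "nat set \<Rightarrow> (nat \<Rightarrow> gen word) monoid" where
  "F2_product I \<equiv> product_group I (\<lambda>_. F2)"

definition factor_embedding :: "nat set \<Rightarrow> nat \<Rightarrow> gen word \<Rightarrow> nat \<Rightarrow> gen word" where
  "factor_embedding I i y = (\<lambda>j\<in>I. if j = i then y else \<one>\<^bsub>F2\<^esub>)"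

definition z1 :: "nat \<Rightarrow> nat \<Rightarrow> gen word" where "z1 r = (\<lambda>i\<in>{1..r}. F2_a)"
definition z2 :: "nat \<Rightarrow> nat \<Rightarrow> gen word" where "z2 r = (\<lambda>i\<in>{1..r}. F2_b)"
definition z3 :: "nat \<Rightarrow> nat \<Rightarrow> gen word" where "z3 r = (\<lambda>i\<in>{1..r}. F2_a [^]\<^bsub>F2\<^esub> i)"
definition z4 :: "nat \<Rightarrow> nat \<Rightarrow> gen word" where "z4 r = (\<lambda>i\<in>{1..r}. F2_b [^]\<^bsub>F2\<^esub> i)"

definition admissible_Y :: "nat \<Rightarrow> (nat \<Rightarrow> gen word set) \<Rightarrow> bool" where
  "admissible_Y r Y \<longleftrightarrow> (\<forall>i\<in>{1..r}. finite (Y i) \<and> Y i \<subseteq> carrier F2 \<and>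
     normal_closure F2 (Y i) = lower_central F2 (r - 1))"

definition H_subgroup :: "nat \<Rightarrow> (nat \<Rightarrow> gen word set) \<Rightarrow> (nat \<Rightarrow> gen word) set" where
  "H_subgroup r Y = generate (F2_product {1..r})
     ((\<Union>i\<in>{1..r}. factor_embedding {1..r} i ` Y i) \<union> {z1 r, z2 r, z3 r, z4 r})"

definition projection_from_2 :: "nat \<Rightarrow> (nat \<Rightarrow> gen word) \<Rightarrow> nat \<Rightarrow> gen word" where
  "projection_from_2 r g = restrict g {2..r}"

definition G2_group :: "nat \<Rightarrow> (nat \<Rightarrow> gen word set) \<Rightarrow> (nat \<Rightarrow> gen word) monoid" where
  "G2_group r Y = (F2_product {2..r})\<lparr>carrier := projection_from_2 r ` H_subgroup r Y\<rparr>"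

end

theory Submission
  imports Defs
begin

text \<open>
  The group \<open>G\<^sub>2\<^sub>,\<^sub>r\<close> forgets the first coordinate of \<open>H\<^sub>r\<close>, and the forgotten coordinate measures area.
  Lift each generator of a presentation of \<open>G\<^sub>2\<^sub>,\<^sub>r\<close> to \<open>H\<^sub>r\<close> and read off its first coordinate in \<open>F\<^sub>2\<close>;
  this evaluates all words in \<open>F\<^sub>2\<close>. Null-homotopic words land in the intersection \<open>K\<close> of
  \<open>H\<^sub>r\<close> with the first factor, and a product of \<open>k\<close> conjugates of relators lands in a product of \<open>k\<close>
  conjugates of finitely many elements of \<open>K\<close>. If some additive, conjugation invariant
  \<open>\<chi> : K \<rightarrow> \<int>\<close> is given, then the area is at least a constant times \<open>\<chi>\<close> (\<open>area_lower_bound\<close>).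

  The function \<open>\<chi>\<close> comes from the Magnus expansion \<open>a \<mapsto> 1 + A\<close>, \<open>b \<mapsto> 1 + B\<close>. On elements whose
  expansion has no terms in degrees \<open>1, \<dots>, r - 2\<close>, every coefficient of degree \<open>r - 1\<close> is additive and
  conjugation invariant. Only the coefficient of \<open>A B\<^sup>r\<^sup>-\<^sup>2\<close> is needed, and the coefficients at the
  subwords of this monomial form a unitriangular integer matrix that depends multiplicatively on the
  element. So the expansion is replaced by a representation by unitriangular matrices,
  filtered by the number of vanishing superdiagonals; commutators add up in this filtration
  (\<open>gap_commutator\<close>), which sends \<open>\<gamma>\<^sub>c\<close> into its term \<open>c\<close>.

  That all elements of \<open>K\<close> have no terms in degrees \<open>1, \<dots>, r - 2\<close> is the point at which the exponents
  in \<open>z\<^sub>3\<close> and \<open>z\<^sub>4\<close> enter. Modulo \<open>\<gamma>\<^sub>r\<^sub>-\<^sub>1\<close>, coordinate \<open>t\<close> of an element of \<open>H\<^sub>r\<close> is \<open>v(a, b, a\<^sup>t, b\<^sup>t)\<close> with one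
  word \<open>v\<close> for all \<open>t\<close>, and its terms of degree \<open>l\<close> are polynomials of degree at most \<open>l\<close> in \<open>t\<close>. If the
  coordinates \<open>2, \<dots>, r\<close> are trivial, then these polynomials have \<open>r - 1 > l\<close> zeros, hence they vanish at
  \<open>t = 1\<close> (\<open>poly_coordinates_first_gap\<close>).

  Finally, \<open>H\<^sub>r\<close> contains for each \<open>t = 2, \<dots>, r\<close> an element with trivial coordinate \<open>t\<close> and with first
  coordinate \<open>a\<close> (for \<open>t = 2\<close>) or \<open>b\<^sup>t\<^sup>-\<^sup>1\<close>. The iterated commutator of the \<open>n\<close>-th powers of words for
  their projections has length linear in \<open>n\<close>. It is null-homotopic, since every coordinate is trivial
  in one of its entries, and it has \<open>\<chi> = (r - 1)! n\<^sup>r\<^sup>-\<^sup>1\<close> (\<open>iterated_commutator_leading_entry\<close>).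
\<close>

section \<open>Evaluation of words\<close>

lemma word_eval_Nil [simp]: "word_eval G \<phi> [] = \<one>\<^bsub>G\<^esub>"
  by (simp add: word_eval_def)

lemma word_eval_Cons [simp]:
  "word_eval G \<phi> (l # w) =
     (if snd l then \<phi> (fst l) else inv\<^bsub>G\<^esub> (\<phi> (fst l))) \<otimes>\<^bsub>G\<^esub> word_eval G \<phi> w"
  by (cases l) (simp add: word_eval_def)

lemma words_Cons [simp]: "l # w \<in> words X \<longleftrightarrow> fst l \<in> X \<and> w \<in> words X"
  by (cases l) (auto simp: words_def)

lemma words_append_iff [simp]: "u @ v \<in> words X \<longleftrightarrow> u \<in> words X \<and> v \<in> words X"
  by (auto simp: words_def)

lemma word_inv_word_inv [simp]: "word_inv (word_inv w) = w"
  by (induction w) (auto simp: word_inv_def)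

lemma words_word_inv_iff [simp]: "word_inv w \<in> words X \<longleftrightarrow> w \<in> words X"
  using words_word_inv[of w X] words_word_inv[of "word_inv w" X] by auto

lemma word_inv_Nil [simp]: "word_inv [] = []"
  by (simp add: word_inv_def)

lemma word_inv_Cons: "word_inv (l # w) = word_inv w @ [letter_inv l]"
  by (simp add: word_inv_def)

lemma word_inv_append: "word_inv (u @ v) = word_inv v @ word_inv u"
  by (simp add: word_inv_def)

lemma length_word_inv [simp]: "length (word_inv w) = length w"
  by (simp add: word_inv_def)

context group
begin

lemma word_eval_closed:
  assumes "\<phi> \<in> X \<rightarrow> carrier G" "w \<in> words X"
  shows "word_eval G \<phi> w \<in> carrier G"
  using assms(2)
proof (induction w)
  case (Cons l w)
  with assms(1) have "\<phi> (fst l) \<in> carrier G" by auto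
  with Cons show ?case by simp
qed simp

lemma word_eval_append:
  assumes "\<phi> \<in> X \<rightarrow> carrier G" "u \<in> words X" "v \<in> words X"
  shows "word_eval G \<phi> (u @ v) = word_eval G \<phi> u \<otimes> word_eval G \<phi> v"
  using assms(2)
proof (induction u)
  case Nil
  show ?case using assms(3) by (simp add: word_eval_closed[OF assms(1)])
next
  case (Cons l u)
  with assms(1) have "\<phi> (fst l) \<in> carrier G" by auto
  with Cons assms show ?case by (simp add: m_assoc word_eval_closed[OF assms(1)])
qed

lemma word_eval_word_inv:
  assumes "\<phi> \<in> X \<rightarrow> carrier G" "w \<in> words X"
  shows "word_eval G \<phi> (word_inv w) = inv (word_eval G \<phi> w)"
  using assms(2)
proof (induction w)
  case (Cons l w)
  with assms(1) have l: "\<phi> (fst l) \<in> carrier G" by auto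
  have "word_eval G \<phi> (word_inv (l # w))
      = word_eval G \<phi> (word_inv w) \<otimes> word_eval G \<phi> [letter_inv l]"
    unfolding word_inv_Cons using Cons.prems
    by (intro word_eval_append[OF assms(1)]) (auto simp: letter_inv_def Nil_words)
  with Cons l show ?case
    by (simp add: letter_inv_def inv_mult_group word_eval_closed[OF assms(1)])
qed simp

lemma word_eval_free_reduce:
  assumes "\<phi> \<in> X \<rightarrow> carrier G" "w \<in> words X"
  shows "word_eval G \<phi> (free_reduce w) = word_eval G \<phi> w"
  using assms(2)
proof (induction w)
  case (Cons l w)
  with assms(1) have l: "\<phi> (fst l) \<in> carrier G" by auto
  have step: "word_eval G \<phi> (cancel_Cons l v) = word_eval G \<phi> (l # v)" if "v \<in> words X" for v
  proof (cases v)
    case (Cons m u)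
    with that l show ?thesis
      by (auto simp: letter_inv_def m_assoc[symmetric] word_eval_closed[OF assms(1)])
  qed simp
  have "free_reduce (l # w) = cancel_Cons l (free_reduce w)"
    by (simp add: free_reduce_def)
  with Cons step[of "free_reduce w"] show ?case
    by (simp add: words_free_reduce)
qed (simp add: free_reduce_def)

lemma word_eval_hom_free_group:
  assumes "\<phi> \<in> X \<rightarrow> carrier G"
  shows "word_eval G \<phi> \<in> hom (free_group X) G"
  by (rule homI) (auto simp: free_group_def assms word_eval_closed[OF assms]
      word_eval_free_reduce[OF assms] word_eval_append[OF assms])

end

lemma hom_word_eval:
  assumes "group G" "group K" "f \<in> hom G K" "\<psi> \<in> X \<rightarrow> carrier G"
    and "\<And>x. x \<in> X \<Longrightarrow> f (\<psi> x) = \<phi> x" and "w \<in> words X"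
  shows "f (word_eval G \<psi> w) = word_eval K \<phi> w"
proof -
  interpret group_hom G K f
    using assms by (simp add: group_hom_def group_hom_axioms_def)
  show ?thesis using assms(6)
  proof (induction w)
    case (Cons l w)
    with assms(4) have "\<psi> (fst l) \<in> carrier G" by auto
    with Cons show ?case
      using assms(5) by (simp add: G.word_eval_closed[OF assms(4)])
  qed simp
qed


section \<open>Area as a number of conjugates of relators\<close>

abbreviation conj_product :: "('x word \<times> 'x word) list \<Rightarrow> 'x word" where
  "conj_product cs \<equiv> concat (map (\<lambda>(\<theta>, \<rho>). \<theta> @ \<rho> @ word_inv \<theta>) cs)"

lemma free_reduce_cong_middle:
  assumes "free_reduce u = free_reduce u'"
  shows "free_reduce (x @ u @ y) = free_reduce (x @ u' @ y)"
  using assms by (metis free_reduce_append_left free_reduce_append_right)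

lemma free_reduce_cancel_middle: "free_reduce (x @ word_inv w @ w @ y) = free_reduce (x @ y)"
  using free_reduce_cong_middle[of "word_inv w @ w" "[]" x y]
  by (simp add: free_reduce_word_inv_append free_reduce_reduced reduced_Nil)

lemma word_inv_conj_product:
  "word_inv (conj_product cs) = conj_product (rev (map (\<lambda>(\<theta>, \<rho>). (\<theta>, word_inv \<rho>)) cs))"
  by (induction cs) (auto simp: word_inv_append)

lemma conjugate_conj_product:
  "free_reduce (g @ conj_product cs @ word_inv g)
     = free_reduce (conj_product (map (\<lambda>(\<theta>, \<rho>). (g @ \<theta>, \<rho>)) cs))"
proof (induction cs)
  case Nil
  show ?case using free_reduce_cancel_middle[of "[]" "word_inv g" "[]"] by simp
next
  case (Cons c cs)
  obtain \<theta> \<rho> where c: "c = (\<theta>, \<rho>)" by (cases c)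
  define u where "u = (g @ \<theta>) @ \<rho> @ word_inv (g @ \<theta>)"
  define rest where "rest = conj_product cs"
  have "free_reduce (g @ conj_product (c # cs) @ word_inv g)
      = free_reduce ((g @ \<theta> @ \<rho> @ word_inv \<theta>) @ rest @ word_inv g)"
    by (simp add: c rest_def)
  also have "\<dots> = free_reduce ((g @ \<theta> @ \<rho> @ word_inv \<theta>) @ word_inv g @ g @ rest @ word_inv g)"
    by (simp only: free_reduce_cancel_middle)
  also have "\<dots> = free_reduce (u @ (g @ rest @ word_inv g) @ [])"
    by (simp add: u_def word_inv_append)
  also have "\<dots> = free_reduce (u @ conj_product (map (\<lambda>(\<theta>, \<rho>). (g @ \<theta>, \<rho>)) cs) @ [])"
    by (rule free_reduce_cong_middle) (use Cons.IH rest_def in simp)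
  finally show ?case by (simp add: c u_def)
qed

lemma conj_product_words:
  assumes "set cs \<subseteq> words X \<times> words X"
  shows "conj_product cs \<in> words X"
  using assms by (induction cs) (auto simp: Nil_words)

lemma free_group_mult: "u \<otimes>\<^bsub>free_group X\<^esub> v = free_reduce (u @ v)"
  by (simp add: free_group_def)

text \<open>The products of conjugates of relators form a normal subgroup, so they exhaust the normal
  closure. This makes the minimum in the definition of the area an attained one.\<close>

lemma normal_closure_conj_product:
  assumes R: "R \<subseteq> words X" and w: "w \<in> normal_closure (free_group X) (free_reduce ` R)"
  shows "\<exists>cs. set cs \<subseteq> words X \<times> (R \<union> word_inv ` R) \<and> w = free_reduce (conj_product cs)"
proof -
  interpret F: group "free_group X" by (rule group_free_group)
  let ?C = "{cs. set cs \<subseteq> words X \<times> (R \<union> word_inv ` R)}"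
  define N where "N = (\<lambda>cs. free_reduce (conj_product cs)) ` ?C"
  have words: "conj_product cs \<in> words X" if "cs \<in> ?C" for cs
    by (rule conj_product_words) (use that R in fastforce)
  have carrier: "N \<subseteq> carrier (free_group X)"
    using words by (auto simp: N_def free_group_def words_free_reduce reduced_free_reduce)
  have inv: "inv\<^bsub>free_group X\<^esub> w = free_reduce (word_inv w)" if "w \<in> carrier (free_group X)" for w
    using that
    by (intro F.inv_equality) (auto simp: free_group_def free_reduce_append_left
        free_reduce_word_inv_append words_free_reduce reduced_free_reduce)
  have inv_free_reduce: "free_reduce (word_inv (free_reduce u)) = free_reduce (word_inv u)" for u :: "'a word"
  proof -
    have "free_reduce (word_inv u) = free_reduce (word_inv u @ free_reduce u @ word_inv (free_reduce u))"
      using free_reduce_cancel_middle[of "word_inv u" "word_inv (free_reduce u)" "[]"] by simp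
    also have "\<dots> = free_reduce (word_inv u @ u @ word_inv (free_reduce u))"
      by (rule free_reduce_cong_middle) (simp add: free_reduce_reduced reduced_free_reduce)
    also have "\<dots> = free_reduce (word_inv (free_reduce u))"
      using free_reduce_cancel_middle[of "[]" u] by simp
    finally show ?thesis by simp
  qed
  have "N \<lhd> free_group X"
  proof (rule F.normal_invI)
    show "subgroup N (free_group X)"
    proof (rule F.subgroupI)
      show "N \<noteq> {}" by (auto simp: N_def intro!: exI[of _ "[]"])
      fix a assume "a \<in> N"
      then obtain cs where cs: "cs \<in> ?C" "a = free_reduce (conj_product cs)"
        by (auto simp: N_def)
      have "rev (map (\<lambda>(\<theta>, \<rho>). (\<theta>, word_inv \<rho>)) cs) \<in> ?C"
        using cs(1) by fastforce
      moreover have "inv\<^bsub>free_group X\<^esub> a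
          = free_reduce (conj_product (rev (map (\<lambda>(\<theta>, \<rho>). (\<theta>, word_inv \<rho>)) cs)))"
        using inv carrier \<open>a \<in> N\<close>
        by (simp only: word_inv_conj_product[symmetric]) (auto simp: cs(2) inv_free_reduce)
      ultimately show "inv\<^bsub>free_group X\<^esub> a \<in> N" unfolding N_def by blast
    next
      fix a b assume "a \<in> N" "b \<in> N"
      then obtain cs ds where *: "cs \<in> ?C" "a = free_reduce (conj_product cs)"
          "ds \<in> ?C" "b = free_reduce (conj_product ds)"
        by (auto simp: N_def)
      then have "a \<otimes>\<^bsub>free_group X\<^esub> b = free_reduce (conj_product (cs @ ds))"
        by (simp add: free_group_def free_reduce_append_left free_reduce_append_right)
      moreover have "cs @ ds \<in> ?C" using * by auto
      ultimately show "a \<otimes>\<^bsub>free_group X\<^esub> b \<in> N" unfolding N_def by blast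
    qed (rule carrier)
    fix g h assume g: "g \<in> carrier (free_group X)" and "h \<in> N"
    then obtain cs where cs: "cs \<in> ?C" "h = free_reduce (conj_product cs)"
      by (auto simp: N_def)
    have "g \<otimes>\<^bsub>free_group X\<^esub> h \<otimes>\<^bsub>free_group X\<^esub> inv\<^bsub>free_group X\<^esub> g
        = free_reduce (g @ conj_product cs @ word_inv g)"
    proof -
      have "g \<otimes>\<^bsub>free_group X\<^esub> h = free_reduce (g @ conj_product cs)"
        by (simp add: cs(2) free_group_mult free_reduce_append_right)
      then show ?thesis
        by (simp only: inv[OF g] free_group_mult free_reduce_append_left free_reduce_append_right append_assoc)
    qed
    also have "\<dots> = free_reduce (conj_product (map (\<lambda>(\<theta>, \<rho>). (g @ \<theta>, \<rho>)) cs))"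
      by (rule conjugate_conj_product)
    finally have "g \<otimes>\<^bsub>free_group X\<^esub> h \<otimes>\<^bsub>free_group X\<^esub> inv\<^bsub>free_group X\<^esub> g
        = free_reduce (conj_product (map (\<lambda>(\<theta>, \<rho>). (g @ \<theta>, \<rho>)) cs))" .
    moreover have "map (\<lambda>(\<theta>, \<rho>). (g @ \<theta>, \<rho>)) cs \<in> ?C"
      using cs(1) g by (fastforce simp: free_group_def)
    ultimately show "g \<otimes>\<^bsub>free_group X\<^esub> h \<otimes>\<^bsub>free_group X\<^esub> inv\<^bsub>free_group X\<^esub> g \<in> N"
      unfolding N_def by blast
  qed
  moreover have "free_reduce ` R \<subseteq> N"
  proof
    fix u assume "u \<in> free_reduce ` R"
    then obtain \<rho> where "\<rho> \<in> R" "u = free_reduce \<rho>" by blast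
    then have "u = free_reduce (conj_product [([], \<rho>)])" "[([], \<rho>)] \<in> ?C"
      by (auto simp: Nil_words)
    then show "u \<in> N" unfolding N_def by blast
  qed
  ultimately have "w \<in> N" using w by (auto simp: normal_closure_def)
  then show ?thesis by (auto simp: N_def)
qed

lemma area_attained:
  assumes "finite_presentation G X R \<phi>" and "null_homotopic G X \<phi> w"
  shows "\<exists>cs. length cs = area X R w \<and> set cs \<subseteq> words X \<times> (R \<union> word_inv ` R) \<and>
     free_reduce w = free_reduce (conj_product cs)"
proof -
  have G: "group G" "\<phi> \<in> X \<rightarrow> carrier G" and R: "R \<subseteq> words X"
    and kernel: "kernel (free_group X) G (word_eval G \<phi>) = normal_closure (free_group X) (free_reduce ` R)"
    using assms(1) by (auto simp: finite_presentation_def)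
  have w: "w \<in> words X" "word_eval G \<phi> w = \<one>\<^bsub>G\<^esub>"
    using assms(2) by (auto simp: null_homotopic_def)
  then have "free_reduce w \<in> kernel (free_group X) G (word_eval G \<phi>)"
    by (simp add: kernel_def free_group_def words_free_reduce reduced_free_reduce
        group.word_eval_free_reduce[OF G])
  from normal_closure_conj_product[OF R this[unfolded kernel]]
  have "\<exists>k cs. length cs = k \<and> set cs \<subseteq> words X \<times> (R \<union> word_inv ` R) \<and>
     free_reduce w = free_reduce (conj_product cs)" by blast
  from LeastI_ex[OF this] show ?thesis unfolding area_def .
qed

lemma relator_null_homotopic:
  assumes "finite_presentation G X R \<phi>" and "\<rho> \<in> R"
  shows "null_homotopic G X \<phi> \<rho>"
proof -
  have G: "group G" "\<phi> \<in> X \<rightarrow> carrier G" and R: "\<rho> \<in> words X"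
    and kernel: "kernel (free_group X) G (word_eval G \<phi>) = normal_closure (free_group X) (free_reduce ` R)"
    using assms by (auto simp: finite_presentation_def)
  have "free_reduce \<rho> \<in> kernel (free_group X) G (word_eval G \<phi>)"
    using assms(2) by (auto simp: kernel normal_closure_def)
  then show ?thesis
    using R by (simp add: kernel_def null_homotopic_def group.word_eval_free_reduce[OF G])
qed

text \<open>A bound on the area from below needs only an additive, conjugation invariant function on the
  elements that null-homotopic words represent in some other group \<open>U\<close>: each conjugate of a relator
  changes its value by at most the largest value on a relator.\<close>

lemma area_lower_bound:
  fixes \<chi> :: "'u \<Rightarrow> int"
  assumes pres: "finite_presentation G X R \<phi>" and U: "group U" and \<theta>: "\<theta> \<in> X \<rightarrow> carrier U"
    and D: "\<And>w. null_homotopic G X \<phi> w \<Longrightarrow> word_eval U \<theta> w \<in> D"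
    and add: "\<And>M N. M \<in> D \<Longrightarrow> N \<in> D \<Longrightarrow> \<chi> (M \<otimes>\<^bsub>U\<^esub> N) = \<chi> M + \<chi> N"
    and conj: "\<And>M N. M \<in> carrier U \<Longrightarrow> N \<in> D \<Longrightarrow> \<chi> (M \<otimes>\<^bsub>U\<^esub> N \<otimes>\<^bsub>U\<^esub> inv\<^bsub>U\<^esub> M) = \<chi> N"
  obtains B :: nat where
    "\<And>w. null_homotopic G X \<phi> w \<Longrightarrow> \<chi> (word_eval U \<theta> w) \<le> int B * int (area X R w)"
proof
  interpret U: group U by (rule U)
  interpret G: group G using pres by (simp add: finite_presentation_def)
  have \<phi>: "\<phi> \<in> X \<rightarrow> carrier G" and R: "R \<subseteq> words X" "finite R"
    using pres by (auto simp: finite_presentation_def)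
  let ?E = "word_eval U \<theta>"
  define B where "B = (\<Sum>\<rho>\<in>R. nat \<bar>\<chi> (?E \<rho>)\<bar>)"
  have one: "\<one>\<^bsub>U\<^esub> \<in> D" using D[of "[]"] by (simp add: null_homotopic_def Nil_words)
  then have \<chi>_one: "\<chi> \<one>\<^bsub>U\<^esub> = 0" using add[OF one one] by simp
  have null_relator: "null_homotopic G X \<phi> \<rho>" if "\<rho> \<in> R \<union> word_inv ` R" for \<rho>
    using that relator_null_homotopic[OF pres]
    by (auto simp: null_homotopic_def G.word_eval_word_inv[OF \<phi>])
  have \<chi>_relator: "\<bar>\<chi> (?E \<rho>)\<bar> \<le> int B" if "\<rho> \<in> R \<union> word_inv ` R" for \<rho>
  proof -
    have le: "\<bar>\<chi> (?E \<sigma>)\<bar> \<le> int B" if "\<sigma> \<in> R" for \<sigma>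
    proof -
      have "nat \<bar>\<chi> (?E \<sigma>)\<bar> \<le> B" unfolding B_def
        by (rule member_le_sum) (use that R(2) in auto)
      then show ?thesis by linarith
    qed
    consider "\<rho> \<in> R" | \<sigma> where "\<sigma> \<in> R" "\<rho> = word_inv \<sigma>" using \<open>\<rho> \<in> R \<union> word_inv ` R\<close> by blast
    then show ?thesis
    proof cases
      case 2
      then have \<sigma>: "\<sigma> \<in> words X" using R by blast
      have "?E \<sigma> \<in> D" "?E \<rho> \<in> D" using D null_relator 2 by auto
      from add[OF this] have "\<chi> (?E \<rho>) = - \<chi> (?E \<sigma>)"
        using \<sigma> by (simp add: 2 U.word_eval_word_inv[OF \<theta>] \<chi>_one U.word_eval_closed[OF \<theta>])
      with le[OF 2(1)] show ?thesis by simp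
    qed (rule le)
  qed
  have product: "null_homotopic G X \<phi> (conj_product cs) \<and>
      \<bar>\<chi> (?E (conj_product cs))\<bar> \<le> int B * int (length cs)"
    if "set cs \<subseteq> words X \<times> (R \<union> word_inv ` R)" for cs
    using that
  proof (induction cs)
    case Nil
    then show ?case by (simp add: \<chi>_one null_homotopic_def Nil_words)
  next
    case (Cons c cs)
    obtain \<alpha> \<rho> where c: "c = (\<alpha>, \<rho>)" by (cases c)
    let ?c = "\<alpha> @ \<rho> @ word_inv \<alpha>"
    have \<rho>: "\<rho> \<in> R \<union> word_inv ` R" and \<alpha>: "\<alpha> \<in> words X" using Cons.prems c by auto
    have \<rho>_words: "\<rho> \<in> words X" and \<rho>_one: "word_eval G \<phi> \<rho> = \<one>\<^bsub>G\<^esub>"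
      using null_relator[OF \<rho>] by (auto simp: null_homotopic_def)
    have null_c: "null_homotopic G X \<phi> ?c"
      using \<alpha> \<rho>_words \<rho>_one
      by (simp add: null_homotopic_def G.word_eval_append[OF \<phi>] G.word_eval_word_inv[OF \<phi>]
          G.word_eval_closed[OF \<phi>])
    have "\<chi> (?E ?c) = \<chi> (?E \<rho>)"
      using conj[OF U.word_eval_closed[OF \<theta> \<alpha>] D[OF null_relator[OF \<rho>]]] \<alpha> \<rho>_words
      by (simp add: U.word_eval_append[OF \<theta>] U.word_eval_word_inv[OF \<theta>]
          U.word_eval_closed[OF \<theta>] U.m_assoc)
    then have \<chi>_c: "\<bar>\<chi> (?E ?c)\<bar> \<le> int B" using \<chi>_relator[OF \<rho>] by simp
    have IH: "null_homotopic G X \<phi> (conj_product cs)"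
        "\<bar>\<chi> (?E (conj_product cs))\<bar> \<le> int B * int (length cs)"
      using Cons by auto
    have split: "conj_product (c # cs) = ?c @ conj_product cs" by (simp add: c)
    have w: "?c \<in> words X" "conj_product cs \<in> words X"
      using null_c IH(1) by (auto simp: null_homotopic_def)
    have "?E (conj_product (c # cs)) = ?E ?c \<otimes>\<^bsub>U\<^esub> ?E (conj_product cs)"
      unfolding split by (rule U.word_eval_append[OF \<theta> w])
    then have "\<chi> (?E (conj_product (c # cs))) = \<chi> (?E ?c) + \<chi> (?E (conj_product cs))"
      using add[OF D[OF null_c] D[OF IH(1)]] by simp
    moreover have "null_homotopic G X \<phi> (conj_product (c # cs))"
      using null_c IH(1) w unfolding split
      by (simp only: null_homotopic_def G.word_eval_append[OF \<phi> w]) simp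
    ultimately show ?case using \<chi>_c IH(2) by (simp add: algebra_simps)
  qed
  fix w assume w: "null_homotopic G X \<phi> w"
  obtain cs where cs: "length cs = area X R w" "set cs \<subseteq> words X \<times> (R \<union> word_inv ` R)"
      "free_reduce w = free_reduce (conj_product cs)"
    using area_attained[OF pres w] by blast
  have words: "w \<in> words X" "conj_product cs \<in> words X"
    using w product[OF cs(2)] by (auto simp: null_homotopic_def)
  have "?E w = ?E (conj_product cs)"
    using cs(3) U.word_eval_free_reduce[OF \<theta> words(1)] U.word_eval_free_reduce[OF \<theta> words(2)]
    by simp
  with product[OF cs(2)] cs(1) show "\<chi> (?E w) \<le> int B * int (area X R w)"
    by (simp add: abs_le_iff)
qed


section \<open>Infinite unitriangular integer matrices\<close>

type_synonym matrix = "nat \<Rightarrow> nat \<Rightarrow> int"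

definition unitriangular :: "matrix monoid" where
  "unitriangular =
     \<lparr>carrier = {M. (\<forall>i. M i i = 1) \<and> (\<forall>i j. j < i \<longrightarrow> M i j = 0)},
      mult = (\<lambda>M N i j. \<Sum>k=i..j. M i k * N k j),
      one = (\<lambda>i j. if i = j then 1 else 0)\<rparr>"

lemma unitriangular_carrier_iff:
  "M \<in> carrier unitriangular \<longleftrightarrow> (\<forall>i. M i i = 1) \<and> (\<forall>i j. j < i \<longrightarrow> M i j = 0)"
  by (simp add: unitriangular_def)

lemma unitriangular_mult: "(M \<otimes>\<^bsub>unitriangular\<^esub> N) i j = (\<Sum>k=i..j. M i k * N k j)"
  by (simp add: unitriangular_def)

lemma unitriangular_one: "\<one>\<^bsub>unitriangular\<^esub> i j = (if i = j then 1 else 0)"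
  by (simp add: unitriangular_def)

lemma unitriangular_diag [simp]: "M \<in> carrier unitriangular \<Longrightarrow> M i i = 1"
  and unitriangular_below [simp]: "M \<in> carrier unitriangular \<Longrightarrow> j < i \<Longrightarrow> M i j = 0"
  by (auto simp: unitriangular_carrier_iff)

fun left_inverse :: "matrix \<Rightarrow> matrix" where
  "left_inverse M i j = (if j < i then 0 else if i = j then 1
     else - (\<Sum>k\<in>{i..<j}. left_inverse M i k * M k j))"

declare left_inverse.simps [simp del]

lemma left_inverse_below: "j < i \<Longrightarrow> left_inverse M i j = 0"
  and left_inverse_diag: "left_inverse M i i = 1"
  by (subst left_inverse.simps; simp)+

lemma group_unitriangular: "group unitriangular"
proof (rule groupI)
  fix L M N :: matrix
  have "(\<Sum>k=i..j. (\<Sum>l=i..k. L i l * M l k) * N k j) = (\<Sum>l=i..j. L i l * (\<Sum>k=l..j. M l k * N k j))"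
    for i j
  proof -
    have "(\<Sum>k=i..j. (\<Sum>l=i..k. L i l * M l k) * N k j) = (\<Sum>k=i..j. \<Sum>l=i..k. L i l * M l k * N k j)"
      by (simp add: sum_distrib_right)
    also have "\<dots> = (\<Sum>(k, l)\<in>(SIGMA k:{i..j}. {i..k}). L i l * M l k * N k j)"
      by (rule sum.Sigma) auto
    also have "\<dots> = (\<Sum>(l, k)\<in>(SIGMA l:{i..j}. {l..j}). L i l * M l k * N k j)"
      by (rule sum.reindex_bij_witness[of _ "\<lambda>(l, k). (k, l)" "\<lambda>(k, l). (l, k)"]) auto
    also have "\<dots> = (\<Sum>l=i..j. \<Sum>k=l..j. L i l * M l k * N k j)"
      by (rule sum.Sigma[symmetric]) auto
    finally show ?thesis by (simp add: sum_distrib_left mult.assoc)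
  qed
  then show "L \<otimes>\<^bsub>unitriangular\<^esub> M \<otimes>\<^bsub>unitriangular\<^esub> N
      = L \<otimes>\<^bsub>unitriangular\<^esub> (M \<otimes>\<^bsub>unitriangular\<^esub> N)"
    by (intro ext) (simp add: unitriangular_mult)
next
  fix M assume M: "M \<in> carrier unitriangular"
  show "\<one>\<^bsub>unitriangular\<^esub> \<otimes>\<^bsub>unitriangular\<^esub> M = M"
  proof (intro ext)
    fix i j
    have "(\<Sum>k=i..j. (if i = k then 1 else 0) * M k j) = (\<Sum>k=i..j. if i = k then M k j else 0)"
      by (rule sum.cong) auto
    with M show "(\<one>\<^bsub>unitriangular\<^esub> \<otimes>\<^bsub>unitriangular\<^esub> M) i j = M i j"
      by (auto simp: unitriangular_mult unitriangular_one)
  qed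
  have "left_inverse M \<in> carrier unitriangular"
    by (auto simp: unitriangular_carrier_iff left_inverse_below left_inverse_diag)
  moreover have "left_inverse M \<otimes>\<^bsub>unitriangular\<^esub> M = \<one>\<^bsub>unitriangular\<^esub>"
  proof (intro ext)
    fix i j :: nat
    consider "j < i" | "i = j" | "i < j" by linarith
    then show "(left_inverse M \<otimes>\<^bsub>unitriangular\<^esub> M) i j = \<one>\<^bsub>unitriangular\<^esub> i j"
    proof cases
      case 3
      then have "{i..j} = insert j {i..<j}" by auto
      then have "(\<Sum>k=i..j. left_inverse M i k * M k j)
          = left_inverse M i j * M j j + (\<Sum>k\<in>{i..<j}. left_inverse M i k * M k j)"
        by simp
      then show ?thesis
        using 3 M by (simp add: unitriangular_mult unitriangular_one left_inverse.simps[of M i j])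
    qed (use M in \<open>auto simp: unitriangular_mult unitriangular_one left_inverse_diag\<close>)
  qed
  ultimately show "\<exists>N\<in>carrier unitriangular. N \<otimes>\<^bsub>unitriangular\<^esub> M = \<one>\<^bsub>unitriangular\<^esub>"
    by blast
next
  fix M N assume "M \<in> carrier unitriangular" "N \<in> carrier unitriangular"
  then show "M \<otimes>\<^bsub>unitriangular\<^esub> N \<in> carrier unitriangular"
    by (subst unitriangular_carrier_iff) (simp add: unitriangular_mult)
qed (simp add: unitriangular_carrier_iff unitriangular_one)

interpretation U: group unitriangular
  by (rule group_unitriangular)

abbreviation "U \<equiv> unitriangular"

text \<open>The filtration of \<^term>\<open>unitriangular\<close> by the number of vanishing superdiagonals. The first
  superdiagonal that may be nonzero behaves like the leading term of a power series.\<close>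

definition gap :: "nat \<Rightarrow> matrix set" where
  "gap c = {M \<in> carrier U. \<forall>i j. i < j \<longrightarrow> j < i + c \<longrightarrow> M i j = 0}"

lemma gap_carrier: "M \<in> gap c \<Longrightarrow> M \<in> carrier U"
  by (simp add: gap_def)

lemma gap_zero: "M \<in> gap c \<Longrightarrow> 0 < l \<Longrightarrow> l < c \<Longrightarrow> M i (i + l) = 0"
  by (simp add: gap_def)

lemma gapI:
  assumes "M \<in> carrier U" and zero: "\<And>i l. 0 < l \<Longrightarrow> l < c \<Longrightarrow> M i (i + l) = 0"
  shows "M \<in> gap c"
proof -
  have "M i j = 0" if "i < j" "j < i + c" for i j
    using zero[of "j - i" i] that by simp
  with assms(1) show ?thesis by (simp add: gap_def)
qed

lemma gap_1: "gap (Suc 0) = carrier U"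
  by (auto simp: gap_def)

lemma gap_antimono: "c \<le> d \<Longrightarrow> gap d \<subseteq> gap c"
  by (auto simp: gap_def)

text \<open>With \<open>M = 1 + m\<close> and \<open>N = 1 + n\<close> this reads \<open>M N = 1 + m + n + m n\<close>: the product \<open>m n\<close> starts
  on superdiagonal \<open>c + d\<close>, and with a single summand there.\<close>

lemma gap_mult_entry:
  assumes M: "M \<in> gap c" and N: "N \<in> gap d" and c: "0 < c" and d: "0 < d" and l: "0 < l" "l \<le> c + d"
  shows "(M \<otimes>\<^bsub>U\<^esub> N) i (i + l) = M i (i + l) + N i (i + l)
     + (if l = c + d then M i (i + c) * N (i + c) (i + l) else 0)"
proof -
  let ?f = "\<lambda>k. M i k * N k (i + l)"
  let ?S = "insert i (insert (i + l) (if l = c + d then {i + c} else {}))"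
  have zero: "?f k = 0" if k: "k \<in> {i..i + l}" "k \<notin> ?S" for k
  proof -
    obtain p q where p: "k = i + p" "0 < p" and q: "i + l = k + q" "0 < q"
    proof -
      have "i < k" "k < i + l" using k by (auto simp: le_less)
      then show ?thesis using that[of "k - i" "i + l - k"] by simp
    qed
    have "p < c \<or> q < d"
    proof (rule ccontr)
      assume "\<not> (p < c \<or> q < d)"
      with p q l have "p = c" "l = c + d" by auto
      with k p show False by simp
    qed
    then show ?thesis
      unfolding q(1) using gap_zero[OF M p(2), of i] gap_zero[OF N q(2), of k] p(1) by auto
  qed
  have "(M \<otimes>\<^bsub>U\<^esub> N) i (i + l) = (\<Sum>k\<in>?S. ?f k)"
    unfolding unitriangular_mult by (rule sum.mono_neutral_right) (use zero l in \<open>auto split: if_splits\<close>)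
  also have "\<dots> = M i (i + l) + N i (i + l)
     + (if l = c + d then M i (i + c) * N (i + c) (i + l) else 0)"
    using gap_carrier[OF M] gap_carrier[OF N] c d l by auto
  finally show ?thesis .
qed

lemma gap_mult_below:
  assumes "M \<in> gap c" "N \<in> gap d" "0 < c" "0 < d" "0 < l" "l < c + d"
  shows "(M \<otimes>\<^bsub>U\<^esub> N) i (i + l) = M i (i + l) + N i (i + l)"
  using gap_mult_entry[OF assms(1-5)] assms(6) by simp

lemma gap_one: "\<one>\<^bsub>U\<^esub> \<in> gap c"
  by (auto simp: gap_def unitriangular_one)

lemma gap_subgroup:
  assumes c: "0 < c"
  shows "subgroup (gap c) U"
proof (rule U.subgroupI)
  show "gap c \<subseteq> carrier U" by (auto simp: gap_def)
  show "gap c \<noteq> {}" using gap_one by blast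
  fix M assume M: "M \<in> gap c"
  have inv: "inv\<^bsub>U\<^esub> M \<in> gap (Suc 0)" using M by (simp add: gap_1 gap_carrier)
  show "inv\<^bsub>U\<^esub> M \<in> gap c"
  proof (rule gapI)
    fix i l assume l: "0 < l" "l < c"
    have "(M \<otimes>\<^bsub>U\<^esub> inv\<^bsub>U\<^esub> M) i (i + l) = M i (i + l) + (inv\<^bsub>U\<^esub> M) i (i + l)"
      by (rule gap_mult_below[OF M inv c]) (use l in auto)
    with M l show "(inv\<^bsub>U\<^esub> M) i (i + l) = 0"
      by (simp add: gap_carrier unitriangular_one gap_zero)
  qed (use M gap_carrier in simp)
next
  fix M N assume M: "M \<in> gap c" and N: "N \<in> gap c"
  show "M \<otimes>\<^bsub>U\<^esub> N \<in> gap c"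
  proof (rule gapI)
    fix i l assume l: "0 < l" "l < c"
    then show "(M \<otimes>\<^bsub>U\<^esub> N) i (i + l) = 0"
      using gap_mult_below[OF M N c c, of l i] gap_zero[OF M] gap_zero[OF N] by simp
  qed (use M N gap_carrier in simp)
qed

abbreviation ucommutator :: "matrix \<Rightarrow> matrix \<Rightarrow> matrix" where
  "ucommutator M N \<equiv> M \<otimes>\<^bsub>U\<^esub> N \<otimes>\<^bsub>U\<^esub> inv\<^bsub>U\<^esub> M \<otimes>\<^bsub>U\<^esub> inv\<^bsub>U\<^esub> N"

lemma ucommutator_mult:
  assumes "M \<in> carrier U" "N \<in> carrier U"
  shows "ucommutator M N \<otimes>\<^bsub>U\<^esub> (N \<otimes>\<^bsub>U\<^esub> M) = M \<otimes>\<^bsub>U\<^esub> N"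
proof -
  have "inv\<^bsub>U\<^esub> M \<otimes>\<^bsub>U\<^esub> inv\<^bsub>U\<^esub> N = inv\<^bsub>U\<^esub> (N \<otimes>\<^bsub>U\<^esub> M)"
    using assms by (simp add: U.inv_mult_group)
  then show ?thesis using assms by (simp add: U.m_assoc)
qed

text \<open>In the identity \<open>[M, N] (N M) = M N\<close>, \<open>M N\<close> and \<open>N M\<close> agree below
  superdiagonal \<open>c + d\<close> and differ there by the commutator of the leading terms.\<close>

lemma gap_commutator:
  assumes M: "M \<in> gap c" and N: "N \<in> gap d" and c: "0 < c" and d: "0 < d"
  shows "ucommutator M N \<in> gap (c + d)"
    and "ucommutator M N i (i + (c + d))
       = M i (i + c) * N (i + c) (i + c + d) - N i (i + d) * M (i + d) (i + c + d)"
proof -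
  let ?Q = "ucommutator M N"
  have MN: "M \<in> carrier U" "N \<in> carrier U" using M N by (auto intro: gap_carrier)
  then have P: "N \<otimes>\<^bsub>U\<^esub> M \<in> gap (Suc 0)" by (simp add: gap_1)
  have Q_entry: "?Q i (i + e) = (M \<otimes>\<^bsub>U\<^esub> N) i (i + e) - (N \<otimes>\<^bsub>U\<^esub> M) i (i + e)"
    if "?Q \<in> gap e" "0 < e" for i e
    using gap_mult_below[OF that(1) P that(2), of e i] that(2) ucommutator_mult[OF MN] by simp
  have "?Q \<in> gap (Suc e)" if "e < c + d" for e
    using that
  proof (induction e)
    case 0
    show ?case using MN by (simp add: gap_1)
  next
    case (Suc e)
    then have Q: "?Q \<in> gap (Suc e)" by simp
    show ?case
    proof (rule gapI)
      fix i l assume l: "0 < l" "l < Suc (Suc e)"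
      show "?Q i (i + l) = 0"
      proof (cases "l = Suc e")
        case True
        then show ?thesis
          using Q_entry[OF Q, of i] gap_mult_below[OF M N c d, of l i]
            gap_mult_below[OF N M d c, of l i] Suc.prems by simp
      next
        case False
        with l have "l < Suc e" by simp
        then show ?thesis using gap_zero[OF Q l(1)] by simp
      qed
    qed (use MN in simp)
  qed
  from this[of "c + d - 1"] show Q: "?Q \<in> gap (c + d)" using c by simp
  show "?Q i (i + (c + d))
      = M i (i + c) * N (i + c) (i + c + d) - N i (i + d) * M (i + d) (i + c + d)"
    using Q_entry[OF Q, of i] gap_mult_entry[OF M N c d, of "c + d" i]
      gap_mult_entry[OF N M d c, of "c + d" i] c d by (simp add: add.commute add.left_commute)
qed

text \<open>Conjugating changes a matrix by a commutator, which lies one step deeper in the filtration; so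
  the leading superdiagonal is conjugation invariant.\<close>

lemma gap_conj_entry:
  assumes M: "M \<in> carrier U" and N: "N \<in> gap c" and c: "0 < c"
  shows "(M \<otimes>\<^bsub>U\<^esub> N \<otimes>\<^bsub>U\<^esub> inv\<^bsub>U\<^esub> M) i (i + c) = N i (i + c)"
proof -
  have NU: "N \<in> carrier U" using N by (rule gap_carrier)
  have M1: "M \<in> gap (Suc 0)" using M by (simp add: gap_1)
  have comm: "ucommutator M N \<in> gap (Suc 0 + c)" by (rule gap_commutator[OF M1 N _ c]) simp
  have "M \<otimes>\<^bsub>U\<^esub> N \<otimes>\<^bsub>U\<^esub> inv\<^bsub>U\<^esub> M = ucommutator M N \<otimes>\<^bsub>U\<^esub> N"
    using M NU by (simp add: U.m_assoc)
  then show ?thesis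
    using gap_mult_below[OF comm N _ c, of c i] gap_zero[OF comm c] c by simp
qed

lemma first_superdiagonal_mult:
  assumes "M \<in> carrier U" "N \<in> carrier U"
  shows "(M \<otimes>\<^bsub>U\<^esub> N) i (Suc i) = M i (Suc i) + N i (Suc i)"
  using gap_mult_below[of M "Suc 0" N "Suc 0" "Suc 0" i] assms by (simp add: gap_1)

lemma first_superdiagonal_inv:
  assumes "M \<in> carrier U"
  shows "(inv\<^bsub>U\<^esub> M) i (Suc i) = - M i (Suc i)"
  using first_superdiagonal_mult[of M "inv\<^bsub>U\<^esub> M" i] assms by (simp add: unitriangular_one)

lemma first_superdiagonal_pow:
  assumes "M \<in> carrier U"
  shows "(M [^]\<^bsub>U\<^esub> (n::nat)) i (Suc i) = int n * M i (Suc i)"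
  by (induction n)
    (use assms in \<open>simp_all add: unitriangular_one first_superdiagonal_mult algebra_simps\<close>)


section \<open>Polynomial functions and powers of a unitriangular matrix\<close>

text \<open>The entries of powers are combinations of binomial coefficients. Finite differences describe
  such integer valued polynomials without rational coefficients, and they suit the two uses made of
  them: powers are given by a recursion in the exponent, and zeros propagate to the neighbouring
  integer.\<close>

fun poly_deg_le :: "nat \<Rightarrow> (nat \<Rightarrow> int) \<Rightarrow> bool" where
  "poly_deg_le 0 f \<longleftrightarrow> (\<forall>t. f (Suc t) = f t)"
| "poly_deg_le (Suc d) f \<longleftrightarrow> poly_deg_le d (\<lambda>t. f (Suc t) - f t)"

lemma poly_deg_le_0: "poly_deg_le 0 f \<longleftrightarrow> (\<exists>c. f = (\<lambda>_. c))"
proof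
  assume *: "poly_deg_le 0 f"
  have "f t = f 0" for t by (induction t) (use * in simp_all)
  then show "\<exists>c. f = (\<lambda>_. c)" by blast
qed auto

lemma poly_deg_le_const: "poly_deg_le d (\<lambda>_. c)"
  by (induction d arbitrary: c) auto

lemma poly_deg_le_Suc: "poly_deg_le d f \<Longrightarrow> poly_deg_le (Suc d) f"
proof (induction d arbitrary: f)
  case (Suc d)
  then show ?case using Suc.IH[of "\<lambda>t. f (Suc t) - f t"] by simp
qed simp

lemma poly_deg_le_mono:
  assumes "poly_deg_le d f" "d \<le> e"
  shows "poly_deg_le e f"
  using assms(2,1) by (induction rule: dec_induct) (blast intro: poly_deg_le_Suc)+

lemma poly_deg_le_add: "poly_deg_le d f \<Longrightarrow> poly_deg_le d g \<Longrightarrow> poly_deg_le d (\<lambda>t. f t + g t)"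
proof (induction d arbitrary: f g)
  case (Suc d)
  then show ?case using Suc.IH[of "\<lambda>t. f (Suc t) - f t" "\<lambda>t. g (Suc t) - g t"]
    by (simp add: algebra_simps)
qed simp

lemma poly_deg_le_scale: "poly_deg_le d f \<Longrightarrow> poly_deg_le d (\<lambda>t. c * f t)"
proof (induction d arbitrary: f)
  case (Suc d)
  then show ?case using Suc.IH[of "\<lambda>t. f (Suc t) - f t"] by (simp add: algebra_simps)
qed simp

lemma poly_deg_le_sum: "(\<And>k. k \<in> A \<Longrightarrow> poly_deg_le d (f k)) \<Longrightarrow> poly_deg_le d (\<lambda>t. \<Sum>k\<in>A. f k t)"
  by (induction A rule: infinite_finite_induct)
    (auto intro: poly_deg_le_add poly_deg_le_const simp del: poly_deg_le.simps)

lemma poly_deg_le_shift: "poly_deg_le d f \<Longrightarrow> poly_deg_le d (\<lambda>t. f (Suc t))"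
proof (induction d arbitrary: f)
  case (Suc d)
  then show ?case using Suc.IH[of "\<lambda>t. f (Suc t) - f t"] by simp
qed simp

lemma poly_deg_le_mult:
  "poly_deg_le d f \<Longrightarrow> poly_deg_le e g \<Longrightarrow> poly_deg_le (d + e) (\<lambda>t. f t * g t)"
proof (induction "d + e" arbitrary: d e f g rule: less_induct)
  case less
  show ?case
  proof (cases "d = 0 \<or> e = 0")
    case True
    then consider c where "f = (\<lambda>_. c)" "d = 0" | c where "g = (\<lambda>_. c)" "e = 0"
      using less.prems poly_deg_le_0 by blast
    then show ?thesis
    proof cases
      case 1
      then show ?thesis using less.prems poly_deg_le_scale by simp
    next
      case 2
      then show ?thesis using poly_deg_le_scale[OF less.prems(1), of c] by (simp add: mult.commute)
    qed
  next
    case False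
    then obtain d' e' where de: "d = Suc d'" "e = Suc e'" by (meson not0_implies_Suc)
    \<comment> \<open>The Leibniz rule for differences.\<close>
    have "poly_deg_le (d + e') (\<lambda>t. f (Suc t) * (g (Suc t) - g t) + (f (Suc t) - f t) * g t)"
    proof (rule poly_deg_le_add)
      show "poly_deg_le (d + e') (\<lambda>t. f (Suc t) * (g (Suc t) - g t))"
        using less.hyps[OF _ poly_deg_le_shift[OF less.prems(1)], of e'] less.prems(2) de by simp
      show "poly_deg_le (d + e') (\<lambda>t. (f (Suc t) - f t) * g t)"
        using less.hyps[OF _ _ less.prems(2), of d' "\<lambda>t. f (Suc t) - f t"] less.prems(1) de by simp
    qed
    moreover have "(\<lambda>t. f (Suc t) * (g (Suc t) - g t) + (f (Suc t) - f t) * g t)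
        = (\<lambda>t. f (Suc t) * g (Suc t) - f t * g t)"
      by (simp add: algebra_simps)
    ultimately show ?thesis using de by simp
  qed
qed

lemma poly_deg_le_zero:
  "poly_deg_le d f \<Longrightarrow> (\<And>t. s < t \<Longrightarrow> t \<le> s + d + 1 \<Longrightarrow> f t = 0) \<Longrightarrow> f s = 0"
proof (induction d arbitrary: f)
  case 0
  then show ?case using "0.prems"(2)[of "Suc s"] by simp
next
  case (Suc d)
  have "f (Suc s) - f s = 0"
    by (rule Suc.IH[of "\<lambda>t. f (Suc t) - f t"]) (use Suc.prems in auto)
  then show ?case using Suc.prems(2)[of "Suc s"] by simp
qed

text \<open>A sequence of unitriangular matrices is a polynomial family if its entries on superdiagonal
  \<open>l\<close> are polynomial functions of degree at most \<open>l\<close>.\<close>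

definition poly_family :: "(nat \<Rightarrow> matrix) \<Rightarrow> bool" where
  "poly_family M \<longleftrightarrow> (\<forall>t. M t \<in> carrier U) \<and> (\<forall>i l. poly_deg_le l (\<lambda>t. M t i (i + l)))"

lemma poly_family_mult:
  assumes M: "poly_family M" and N: "poly_family N"
  shows "poly_family (\<lambda>t. M t \<otimes>\<^bsub>U\<^esub> N t)"
proof -
  have "poly_deg_le l (\<lambda>t. \<Sum>k=i..i + l. M t i k * N t k (i + l))" for i l
  proof (rule poly_deg_le_sum)
    fix k assume "k \<in> {i..i + l}"
    then obtain p q where pq: "k = i + p" "l = p + q"
      using that[of "k - i" "i + l - k"] by auto
    have "poly_deg_le p (\<lambda>t. M t i (i + p))" "poly_deg_le q (\<lambda>t. N t (i + p) (i + p + q))"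
      using M N by (auto simp: poly_family_def)
    from poly_deg_le_mult[OF this] show "poly_deg_le l (\<lambda>t. M t i k * N t k (i + l))"
      by (simp add: pq add.assoc)
  qed
  then show ?thesis using M N by (simp add: poly_family_def unitriangular_mult)
qed

lemma poly_family_const: "M \<in> carrier U \<Longrightarrow> poly_family (\<lambda>_. M)"
  by (simp add: poly_family_def poly_deg_le_const)

lemma poly_family_pow:
  assumes M: "M \<in> carrier U"
  shows "poly_family (\<lambda>t. M [^]\<^bsub>U\<^esub> t)"
proof -
  have "poly_deg_le l (\<lambda>t. (M [^]\<^bsub>U\<^esub> t) i (i + l))" for i l
  proof (induction l rule: less_induct)
    case (less l)
    show ?case
    proof (cases l)
      case 0
      have "(M [^]\<^bsub>U\<^esub> t) i i = 1" for t :: nat using M by simp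
      then show ?thesis by (simp add: 0 M)
    next
      case (Suc m)
      have diff: "(M [^]\<^bsub>U\<^esub> Suc t) i (i + l) - (M [^]\<^bsub>U\<^esub> t) i (i + l)
          = (\<Sum>p\<le>m. M (i + p) (i + l) * (M [^]\<^bsub>U\<^esub> t) i (i + p))" for t :: nat
      proof -
        have "(M [^]\<^bsub>U\<^esub> Suc t) i (i + l) = (\<Sum>k=i..i + l. (M [^]\<^bsub>U\<^esub> t) i k * M k (i + l))"
          by (simp add: unitriangular_mult)
        also have "\<dots> = (\<Sum>p\<le>l. (M [^]\<^bsub>U\<^esub> t) i (i + p) * M (i + p) (i + l))"
          by (rule sum.reindex_bij_witness[of _ "\<lambda>p. i + p" "\<lambda>k. k - i"]) auto
        finally show ?thesis using M by (simp add: Suc mult.commute)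
      qed
      have "poly_deg_le m (\<lambda>t. \<Sum>p\<le>m. M (i + p) (i + l) * (M [^]\<^bsub>U\<^esub> t) i (i + p))"
        by (intro poly_deg_le_sum poly_deg_le_scale)
          (auto simp: Suc intro: poly_deg_le_mono[OF less.IH] simp del: poly_deg_le.simps)
      then show ?thesis unfolding Suc poly_deg_le.simps diff[unfolded Suc] .
    qed
  qed
  then show ?thesis using M by (simp add: poly_family_def)
qed


section \<open>A unitriangular representation of the free group of rank two\<close>

text \<open>The Magnus embedding \<open>a \<mapsto> 1 + A\<close>, \<open>b \<mapsto> 1 + B\<close> into noncommutative power series, read off at
  the subwords of the infinite monomial \<open>A B B B \<dots>\<close>: entry \<open>(i, j)\<close> is the coefficient of the
  subword from position \<open>i\<close> to position \<open>j\<close>.\<close>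

definition magnus_gen :: "gen \<Rightarrow> matrix" where
  "magnus_gen g i j = (if i = j then 1 else if j = Suc i \<and> (g = Gen_a \<longleftrightarrow> i = 0) then 1 else 0)"

definition magnus :: "gen word \<Rightarrow> matrix" where
  "magnus = word_eval U magnus_gen"

lemma magnus_gen_carrier [simp]: "magnus_gen g \<in> carrier U"
  by (auto simp: unitriangular_carrier_iff magnus_gen_def)

lemma magnus_hom: "magnus \<in> hom F2 U"
  unfolding magnus_def by (rule U.word_eval_hom_free_group) simp

interpretation F2: group F2
  by (rule group_free_group)

interpretation magnus: group_hom F2 U magnus
  by (simp add: group_hom_def group_hom_axioms_def magnus_hom F2.group_axioms U.group_axioms)

lemma letter_F2 [simp]: "[(g, True)] \<in> carrier F2"
  by (cases g) (auto simp: free_group_def reduced_def Nil_words)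

lemma magnus_letter: "magnus [(g, True)] = magnus_gen g"
  by (simp add: magnus_def)

lemma (in group) lower_central_subset: "lower_central G c \<subseteq> carrier G"
proof (induction c rule: induct_nat_012)
  case (ge2 c)
  then show ?case
    unfolding lower_central.simps commutator_subgroup_def
    by (intro generate_incl) auto
qed auto

lemma magnus_lower_central: "w \<in> lower_central F2 (Suc c) \<Longrightarrow> magnus w \<in> gap (Suc c)"
proof (induction c arbitrary: w)
  case 0
  then show ?case by (simp add: gap_1)
next
  case (Suc c)
  interpret gap: subgroup "gap (Suc (Suc c))" U by (rule gap_subgroup) simp
  have commutator: "magnus v \<in> gap (Suc (Suc c))" "v \<in> carrier F2"
    if "v \<in> {h \<otimes>\<^bsub>F2\<^esub> k \<otimes>\<^bsub>F2\<^esub> inv\<^bsub>F2\<^esub> h \<otimes>\<^bsub>F2\<^esub> inv\<^bsub>F2\<^esub> k | h k.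
      h \<in> carrier F2 \<and> k \<in> lower_central F2 (Suc c)}" for v
  proof -
    obtain h k where v: "v = h \<otimes>\<^bsub>F2\<^esub> k \<otimes>\<^bsub>F2\<^esub> inv\<^bsub>F2\<^esub> h \<otimes>\<^bsub>F2\<^esub> inv\<^bsub>F2\<^esub> k"
      and h: "h \<in> carrier F2" and k: "k \<in> lower_central F2 (Suc c)"
      using \<open>v \<in> _\<close> by blast
    have k': "k \<in> carrier F2" using k F2.lower_central_subset by blast
    show "v \<in> carrier F2" using v h k' by simp
    have "magnus h \<in> gap (Suc 0)" "magnus k \<in> gap (Suc c)"
      using h Suc.IH[OF k] by (auto simp: gap_1)
    from gap_commutator(1)[OF this] show "magnus v \<in> gap (Suc (Suc c))"
      using h k' by (simp add: v)
  qed
  have "magnus w \<in> gap (Suc (Suc c)) \<and> w \<in> carrier F2"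
    using Suc.prems unfolding lower_central.simps commutator_subgroup_def
  proof (induction rule: generate.induct)
    case one
    show ?case by (simp add: gap_one)
  next
    case (incl v)
    then show ?case using commutator by blast
  next
    case (inv v)
    then show ?case using commutator[OF inv] by simp
  next
    case (eng v w)
    then show ?case by simp
  qed
  then show ?case by simp
qed


section \<open>Elements with polynomial coordinates\<close>

definition agree_below :: "nat \<Rightarrow> matrix \<Rightarrow> matrix \<Rightarrow> bool" where
  "agree_below m M N \<longleftrightarrow> (\<forall>i l. l < m \<longrightarrow> M i (i + l) = N i (i + l))"

lemma agree_below_mult:
  assumes "agree_below m M M'" "agree_below m N N'"
  shows "agree_below m (M \<otimes>\<^bsub>U\<^esub> N) (M' \<otimes>\<^bsub>U\<^esub> N')"
  unfolding agree_below_def unitriangular_mult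
proof (intro allI impI sum.cong refl)
  fix i l k assume l: "l < m" and k: "k \<in> {i..i + l}"
  then have "M i (i + (k - i)) = M' i (i + (k - i))" "N k (k + (i + l - k)) = N' k (k + (i + l - k))"
    using assms unfolding agree_below_def by (metis (no_types) atLeastAtMost_iff diff_le_mono
        diff_add_inverse le_less_trans, metis (no_types) atLeastAtMost_iff diff_le_mono2
        diff_add_inverse le_less_trans)
  then show "M i k * N k (i + l) = M' i k * N' k (i + l)" using k by simp
qed

lemma agree_below_one: "M \<in> gap m \<Longrightarrow> agree_below m M \<one>\<^bsub>U\<^esub>"
  unfolding agree_below_def
proof (intro allI impI)
  fix i l assume M: "M \<in> gap m" and l: "l < m"
  show "M i (i + l) = \<one>\<^bsub>U\<^esub> i (i + l)"
    using gap_zero[OF M _ l] gap_carrier[OF M] by (cases "l = 0") (auto simp: unitriangular_one)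
qed

text \<open>Modulo \<open>\<gamma>\<^sub>m\<close> with \<open>m = r - 1\<close>, the coordinates of the elements of \<open>H\<^sub>r\<close> are the values \<open>v(a, b, a\<^sup>t, b\<^sup>t)\<close>
  of one word \<open>v\<close>. What matters about such a family is that its matrices depend polynomially on the
  coordinate \<open>t\<close>.\<close>

definition poly_coordinates :: "nat \<Rightarrow> nat \<Rightarrow> (nat \<Rightarrow> gen word) \<Rightarrow> bool" where
  "poly_coordinates r m h \<longleftrightarrow> h \<in> carrier (F2_product {1..r}) \<and>
     (\<exists>M. poly_family M \<and> (\<forall>t\<in>{1..r}. agree_below m (magnus (h t)) (M t)))"

lemma F2_product_group: "group (F2_product I)"
  by (rule product_group) (rule F2.group_axioms)

lemma F2_product_inv_coord:
  assumes "h \<in> carrier (F2_product I)" "t \<in> I"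
  shows "(inv\<^bsub>F2_product I\<^esub> h) t = inv\<^bsub>F2\<^esub> (h t)"
  using assms F2.group_axioms by simp

lemma poly_coordinates_mult:
  assumes "poly_coordinates r m g" "poly_coordinates r m h"
  shows "poly_coordinates r m (g \<otimes>\<^bsub>F2_product {1..r}\<^esub> h)"
proof -
  interpret P: group "F2_product {1..r}" by (rule F2_product_group)
  obtain M N where M: "poly_family M" "\<And>t. t \<in> {1..r} \<Longrightarrow> agree_below m (magnus (g t)) (M t)"
    and N: "poly_family N" "\<And>t. t \<in> {1..r} \<Longrightarrow> agree_below m (magnus (h t)) (N t)"
    and gh: "g \<in> carrier (F2_product {1..r})" "h \<in> carrier (F2_product {1..r})"
    using assms unfolding poly_coordinates_def by blast
  have "agree_below m (magnus ((g \<otimes>\<^bsub>F2_product {1..r}\<^esub> h) t)) (M t \<otimes>\<^bsub>U\<^esub> N t)" if t: "t \<in> {1..r}" for t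
  proof -
    have "g t \<in> carrier F2" "h t \<in> carrier F2" using gh t by auto
    then have "magnus ((g \<otimes>\<^bsub>F2_product {1..r}\<^esub> h) t) = magnus (g t) \<otimes>\<^bsub>U\<^esub> magnus (h t)"
      using t by simp
    then show ?thesis using agree_below_mult[OF M(2)[OF t] N(2)[OF t]] by simp
  qed
  then show ?thesis
    unfolding poly_coordinates_def using P.m_closed[OF gh] poly_family_mult[OF M(1) N(1)] by blast
qed

lemma poly_coordinates_pow_generator:
  assumes "h = (\<lambda>t\<in>{1..r}. [(g, True)] [^]\<^bsub>F2\<^esub> t)"
  shows "poly_coordinates r m h" "poly_coordinates r m (inv\<^bsub>F2_product {1..r}\<^esub> h)"
proof -
  interpret P: group "F2_product {1..r}" by (rule F2_product_group)
  have h: "h \<in> carrier (F2_product {1..r})" using assms by simp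
  have pow: "magnus (h t) = magnus_gen g [^]\<^bsub>U\<^esub> t" if "t \<in> {1..r}" for t
    using that by (simp add: assms magnus.hom_nat_pow magnus_letter)
  have inv: "magnus ((inv\<^bsub>F2_product {1..r}\<^esub> h) t) = (inv\<^bsub>U\<^esub> magnus_gen g) [^]\<^bsub>U\<^esub> t" if t: "t \<in> {1..r}" for t
  proof -
    have "h t \<in> carrier F2" using h t by auto
    then show ?thesis unfolding F2_product_inv_coord[OF h t] using pow[OF t] by (simp add: U.nat_pow_inv)
  qed
  show "poly_coordinates r m h"
    unfolding poly_coordinates_def using h pow poly_family_pow[of "magnus_gen g"]
    by (intro conjI exI[of _ "\<lambda>t. magnus_gen g [^]\<^bsub>U\<^esub> t"]) (auto simp: agree_below_def)
  show "poly_coordinates r m (inv\<^bsub>F2_product {1..r}\<^esub> h)"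
    unfolding poly_coordinates_def using P.inv_closed[OF h] inv poly_family_pow[of "inv\<^bsub>U\<^esub> magnus_gen g"]
    by (intro conjI exI[of _ "\<lambda>t. (inv\<^bsub>U\<^esub> magnus_gen g) [^]\<^bsub>U\<^esub> t"]) (auto simp: agree_below_def)
qed

lemma poly_coordinates_diagonal:
  assumes "h = (\<lambda>t\<in>{1..r}. w)" "w \<in> carrier F2"
  shows "poly_coordinates r m h" "poly_coordinates r m (inv\<^bsub>F2_product {1..r}\<^esub> h)"
proof -
  interpret P: group "F2_product {1..r}" by (rule F2_product_group)
  have h: "h \<in> carrier (F2_product {1..r})" using assms by simp
  have inv: "magnus ((inv\<^bsub>F2_product {1..r}\<^esub> h) t) = inv\<^bsub>U\<^esub> magnus w" if t: "t \<in> {1..r}" for t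
    unfolding F2_product_inv_coord[OF h t] using assms t by simp
  show "poly_coordinates r m h"
    unfolding poly_coordinates_def using h assms poly_family_const[of "magnus w"]
    by (intro conjI exI[of _ "\<lambda>t. magnus w"]) (auto simp: agree_below_def)
  show "poly_coordinates r m (inv\<^bsub>F2_product {1..r}\<^esub> h)"
    unfolding poly_coordinates_def using P.inv_closed[OF h] assms(2) inv poly_family_const[of "inv\<^bsub>U\<^esub> magnus w"]
    by (intro conjI exI[of _ "\<lambda>t. inv\<^bsub>U\<^esub> magnus w"]) (auto simp: agree_below_def)
qed

lemma poly_coordinates_deep:
  assumes h: "h \<in> carrier (F2_product {1..r})" and m: "0 < m"
    and "\<And>t. t \<in> {1..r} \<Longrightarrow> magnus (h t) \<in> gap m"
  shows "poly_coordinates r m h" "poly_coordinates r m (inv\<^bsub>F2_product {1..r}\<^esub> h)"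
proof -
  interpret P: group "F2_product {1..r}" by (rule F2_product_group)
  interpret gap: subgroup "gap m" U by (rule gap_subgroup[OF m])
  have *: "poly_coordinates r m g" if g: "g \<in> carrier (F2_product {1..r})"
    "\<And>t. t \<in> {1..r} \<Longrightarrow> magnus (g t) \<in> gap m" for g
    unfolding poly_coordinates_def using g poly_family_const[OF U.one_closed] agree_below_one by blast
  show "poly_coordinates r m h" by (rule *) (use assms in auto)
  show "poly_coordinates r m (inv\<^bsub>F2_product {1..r}\<^esub> h)"
  proof (rule *)
    fix t assume t: "t \<in> {1..r}"
    then have "h t \<in> carrier F2" using h by auto
    then show "magnus ((inv\<^bsub>F2_product {1..r}\<^esub> h) t) \<in> gap m"
      unfolding F2_product_inv_coord[OF h t] using assms(3)[OF t] by simp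
  qed (use P.inv_closed[OF h] in simp)
qed

text \<open>The entries on superdiagonal \<open>l < r - 1\<close> are polynomials of degree at most \<open>l\<close> in the coordinate
  and vanish at the \<open>r - 1\<close> points \<open>2, \<dots>, r\<close>; so they vanish at \<open>1\<close> too.\<close>

lemma poly_coordinates_first_gap:
  assumes h: "poly_coordinates r (r - 1) h" and r: "1 \<le> r"
    and trivial: "\<And>t. t \<in> {2..r} \<Longrightarrow> h t = \<one>\<^bsub>F2\<^esub>"
  shows "magnus (h 1) \<in> gap (r - 1)"
proof (rule gapI)
  obtain M where M: "poly_family M" "\<And>t. t \<in> {1..r} \<Longrightarrow> agree_below (r - 1) (magnus (h t)) (M t)"
    and h: "h \<in> carrier (F2_product {1..r})"
    using h unfolding poly_coordinates_def by blast
  have "h 1 \<in> carrier F2" using h r by auto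
  then show "magnus (h 1) \<in> carrier U" by simp
  fix i l :: nat assume l: "0 < l" "l < r - 1"
  have entry: "M t i (i + l) = magnus (h t) i (i + l)" if "t \<in> {1..r}" for t
    using M(2)[OF that] l by (simp add: agree_below_def)
  have "M 1 i (i + l) = 0"
  proof (rule poly_deg_le_zero[of l "\<lambda>t. M t i (i + l)" 1])
    show "poly_deg_le l (\<lambda>t. M t i (i + l))" using M(1) by (simp add: poly_family_def)
    fix t assume "1 < t" "t \<le> 1 + l + 1"
    then have "t \<in> {2..r}" "t \<in> {1..r}" using l by auto
    then show "M t i (i + l) = 0"
      using entry trivial l by (simp add: unitriangular_one)
  qed
  then show "magnus (h 1) i (i + l) = 0" using entry[of 1] r by simp
qed


section \<open>Iterated commutator words\<close>

definition word_commutator :: "'x word \<Rightarrow> 'x word \<Rightarrow> 'x word" where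
  "word_commutator u v = u @ v @ word_inv u @ word_inv v"

definition word_power :: "'x word \<Rightarrow> nat \<Rightarrow> 'x word" where
  "word_power u n = concat (replicate n u)"

fun iterated_commutator :: "(nat \<Rightarrow> 'x word) \<Rightarrow> nat \<Rightarrow> nat \<Rightarrow> 'x word" where
  "iterated_commutator u n 0 = word_power (u 0) n"
| "iterated_commutator u n (Suc k) =
     word_commutator (iterated_commutator u n k) (word_power (u (Suc k)) n)"

lemma word_power_words: "u \<in> words X \<Longrightarrow> word_power u n \<in> words X"
  unfolding word_power_def by (induction n) (auto simp: Nil_words)

lemma length_word_power: "length (word_power u n) = length u * n"
  unfolding word_power_def by (induction n) auto

lemma iterated_commutator_words:
  "(\<And>k. u k \<in> words X) \<Longrightarrow> iterated_commutator u n k \<in> words X"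
  by (induction k) (auto simp: word_commutator_def word_power_words)

lemma length_iterated_commutator: "\<exists>L. \<forall>n. length (iterated_commutator u n k) \<le> L * n"
proof (induction k)
  case 0
  show ?case by (auto simp: length_word_power)
next
  case (Suc k)
  then obtain L where L: "\<And>n. length (iterated_commutator u n k) \<le> L * n" by blast
  have "length (iterated_commutator u n (Suc k)) \<le> (2 * L + 2 * length (u (Suc k))) * n" for n
    using L[of n] by (simp add: word_commutator_def length_word_power algebra_simps)
  then show ?case by blast
qed

context group
begin

lemma word_eval_power:
  assumes "\<phi> \<in> X \<rightarrow> carrier G" "u \<in> words X"
  shows "word_eval G \<phi> (word_power u n) = word_eval G \<phi> u [^] n"
proof (induction n)
  case (Suc n)
  have "word_eval G \<phi> (word_power u (Suc n)) = word_eval G \<phi> (u @ word_power u n)"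
    by (simp add: word_power_def)
  with Suc assms show ?case
    using nat_pow_Suc2[OF word_eval_closed[OF assms], of n]
    by (simp add: word_eval_append[OF assms(1)] word_power_words)
qed (simp add: word_power_def)

lemma word_eval_commutator:
  assumes "\<phi> \<in> X \<rightarrow> carrier G" "u \<in> words X" "v \<in> words X"
  shows "word_eval G \<phi> (word_commutator u v) = word_eval G \<phi> u \<otimes> word_eval G \<phi> v
    \<otimes> inv (word_eval G \<phi> u) \<otimes> inv (word_eval G \<phi> v)"
  using assms by (simp add: word_commutator_def word_eval_append[OF assms(1)]
      word_eval_word_inv[OF assms(1)] word_eval_closed[OF assms(1)] m_assoc)

lemma word_eval_iterated_commutator_trivial:
  assumes \<phi>: "\<phi> \<in> X \<rightarrow> carrier G" and u: "\<And>k. u k \<in> words X"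
    and j: "word_eval G \<phi> (u j) = \<one>" "j \<le> k"
  shows "word_eval G \<phi> (iterated_commutator u n k) = \<one>"
  using j(2)
proof (induction k)
  case 0
  then show ?case using j(1) by (simp add: word_eval_power[OF \<phi> u])
next
  case (Suc k)
  let ?c = "word_eval G \<phi> (iterated_commutator u n k)"
  let ?p = "word_eval G \<phi> (u (Suc k)) [^] n"
  have closed: "?c \<in> carrier G" "?p \<in> carrier G"
    by (auto simp: iterated_commutator_words[OF u] word_eval_closed[OF \<phi>] u)
  have eval: "word_eval G \<phi> (iterated_commutator u n (Suc k)) = ?c \<otimes> ?p \<otimes> inv ?c \<otimes> inv ?p"
    by (simp add: word_eval_commutator[OF \<phi>] iterated_commutator_words u word_power_words
        word_eval_power[OF \<phi> u])
  have "?c = \<one> \<or> ?p = \<one>" using Suc j(1) by (cases "j = Suc k") auto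
  then show ?case unfolding eval using closed by auto
qed

end

text \<open>The entry is the coefficient of \<open>[\<dots>[[n A, 2 n B], 3 n B], \<dots>, (k + 1) n B]\<close> at \<open>A B \<dots> B\<close>: all
  other monomials of an iterated commutator of this shape begin with \<open>B\<close>, so nothing cancels.\<close>

lemma iterated_commutator_leading_entry:
  assumes \<theta>: "\<theta> \<in> X \<rightarrow> carrier U" and u: "\<And>k. u k \<in> words X"
    and first: "word_eval U \<theta> (u 0) 0 1 = 1"
    and later: "\<And>k. 0 < k \<Longrightarrow> k \<le> m \<Longrightarrow> word_eval U \<theta> (u k) 0 1 = 0"
      "\<And>k i. 0 < k \<Longrightarrow> k \<le> m \<Longrightarrow> 0 < i \<Longrightarrow> word_eval U \<theta> (u k) i (Suc i) = int (Suc k)"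
  shows "k \<le> m \<Longrightarrow> word_eval U \<theta> (iterated_commutator u n k) \<in> gap (Suc k) \<and>
    word_eval U \<theta> (iterated_commutator u n k) 0 (Suc k) = fact (Suc k) * int n ^ Suc k"
proof (induction k)
  case 0
  show ?case
    using first by (simp add: U.word_eval_power[OF \<theta> u] gap_1 U.word_eval_closed[OF \<theta> u]
        first_superdiagonal_pow)
next
  case (Suc k)
  let ?M = "word_eval U \<theta> (iterated_commutator u n k)"
  let ?N = "word_eval U \<theta> (u (Suc k)) [^]\<^bsub>U\<^esub> n"
  have M: "?M \<in> gap (Suc k)" "?M 0 (Suc k) = fact (Suc k) * int n ^ Suc k"
    using Suc by auto
  have N: "?N \<in> gap (Suc 0)" by (simp add: gap_1 U.word_eval_closed[OF \<theta> u])
  have N_entries: "?N 0 1 = 0" "?N (Suc k) (Suc (Suc k)) = int n * int (Suc (Suc k))"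
    using later[of "Suc k"] Suc.prems
    by (simp_all add: first_superdiagonal_pow U.word_eval_closed[OF \<theta> u])
  have eval: "word_eval U \<theta> (iterated_commutator u n (Suc k)) = ucommutator ?M ?N"
    by (simp add: U.word_eval_commutator[OF \<theta>] iterated_commutator_words u word_power_words
        U.word_eval_power[OF \<theta> u])
  show ?case
    unfolding eval using gap_commutator(1)[OF M(1) N] gap_commutator(2)[OF M(1) N, of 0] M(2) N_entries
    by (simp add: algebra_simps)
qed


section \<open>The lower bound\<close>

context
  fixes r :: nat
    and Y :: "nat \<Rightarrow> gen word set"
    and X :: "'x set"
    and R :: "'x word set"
    and \<phi> :: "'x \<Rightarrow> (nat \<Rightarrow> gen word)"
  assumes r: "r \<ge> 3"
    and Y: "admissible_Y r Y"
    and pres: "finite_presentation (G2_group r Y) X R \<phi>"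
begin

abbreviation (input) "P \<equiv> F2_product {1..r}"
abbreviation (input) "H \<equiv> H_subgroup r Y"
abbreviation (input) "HG \<equiv> P\<lparr>carrier := H\<rparr>"
abbreviation (input) "G \<equiv> G2_group r Y"

interpretation P: group P by (rule F2_product_group)
interpretation G: group G using pres by (simp add: finite_presentation_def)

lemma \<phi>_carrier: "\<phi> \<in> X \<rightarrow> carrier G"
  using pres by (simp add: finite_presentation_def)

lemma Y_carrier: "i \<in> {1..r} \<Longrightarrow> y \<in> Y i \<Longrightarrow> y \<in> carrier F2"
  using Y unfolding admissible_Y_def by blast

lemma magnus_Y:
  assumes "i \<in> {1..r}" "y \<in> Y i"
  shows "magnus y \<in> gap (r - 1)"
proof -
  have "Y i \<subseteq> normal_closure F2 (Y i)" by (auto simp: normal_closure_def)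
  then have "y \<in> lower_central F2 (r - 1)"
    using assms Y unfolding admissible_Y_def by blast
  moreover have "r - 1 = Suc (r - 2)" using r by simp
  ultimately show ?thesis using magnus_lower_central by metis
qed

lemma z_carrier: "z1 r \<in> carrier P" "z2 r \<in> carrier P" "z3 r \<in> carrier P" "z4 r \<in> carrier P"
  by (auto simp: z1_def z2_def z3_def z4_def F2_a_def F2_b_def)

lemma factor_embedding_carrier: "y \<in> carrier F2 \<Longrightarrow> factor_embedding {1..r} i y \<in> carrier P"
  by (auto simp: factor_embedding_def)

lemma H_poly_coordinates:
  assumes "h \<in> H"
  shows "poly_coordinates r (r - 1) h"
proof -
  let ?S = "(\<Union>i\<in>{1..r}. factor_embedding {1..r} i ` Y i) \<union> {z1 r, z2 r, z3 r, z4 r}"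
  have generator: "poly_coordinates r (r - 1) g \<and> poly_coordinates r (r - 1) (inv\<^bsub>P\<^esub> g)"
    if "g \<in> ?S" for g
  proof -
    consider i y where "i \<in> {1..r}" "y \<in> Y i" "g = factor_embedding {1..r} i y"
      | "g = z1 r \<or> g = z2 r" | "g = z3 r \<or> g = z4 r"
      using \<open>g \<in> ?S\<close> by blast
    then show ?thesis
    proof cases
      case 1
      have "g \<in> carrier P" using 1 Y_carrier factor_embedding_carrier by blast
      moreover have "magnus (g t) \<in> gap (r - 1)" if "t \<in> {1..r}" for t
        using that magnus_Y[OF 1(1,2)] gap_one by (simp add: 1(3) factor_embedding_def)
      ultimately show ?thesis using poly_coordinates_deep[of g r "r - 1"] r by simp
    next
      case 2
      then show ?thesis using poly_coordinates_diagonal letter_F2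
        unfolding z1_def z2_def F2_a_def F2_b_def by blast
    next
      case 3
      then show ?thesis using poly_coordinates_pow_generator
        unfolding z3_def z4_def F2_a_def F2_b_def by blast
    qed
  qed
  show ?thesis using assms unfolding H_subgroup_def
  proof (induction rule: generate.induct)
    case one
    have "poly_coordinates r (r - 1) (z1 r \<otimes>\<^bsub>P\<^esub> inv\<^bsub>P\<^esub> z1 r)"
      by (rule poly_coordinates_mult) (use generator in blast)+
    then show ?case by (simp only: P.r_inv[OF z_carrier(1)])
  next
    case (eng g h)
    then show ?case by (intro poly_coordinates_mult)
  qed (use generator in blast)+
qed

lemma subgroup_H: "subgroup H P"
  unfolding H_subgroup_def
  by (rule P.generate_is_subgroup) (use z_carrier Y_carrier factor_embedding_carrier in blast)

interpretation H: subgroup H P by (rule subgroup_H)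
interpretation HG: group HG by (rule H.subgroup_is_group) (rule P.group_axioms)

lemma projection_hom: "projection_from_2 r \<in> hom HG G"
proof (rule homI)
  fix g h assume "g \<in> carrier HG" "h \<in> carrier HG"
  show "projection_from_2 r (g \<otimes>\<^bsub>HG\<^esub> h) = projection_from_2 r g \<otimes>\<^bsub>G\<^esub> projection_from_2 r h"
    by (auto simp: projection_from_2_def G2_group_def fun_eq_iff)
qed (simp add: G2_group_def)

interpretation projection: group_hom HG G "projection_from_2 r"
  by (intro group_hom.intro group_hom_axioms.intro HG.group_axioms G.group_axioms projection_hom)

lemma coord_hom:
  assumes "t \<in> {1..r}"
  shows "(\<lambda>h. h t) \<in> hom HG F2"
proof (rule homI)
  fix h assume "h \<in> carrier HG"
  then have "h \<in> carrier P" using H.subset by auto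
  then show "h t \<in> carrier F2" using assms by auto
qed (use assms in simp)

lemma magnus_first_hom: "(\<lambda>h. magnus (h 1)) \<in> hom HG U"
  using hom_compose[OF coord_hom[of 1] magnus_hom] r by (simp add: o_def)

interpretation first: group_hom HG U "\<lambda>h. magnus (h 1)"
  by (intro group_hom.intro group_hom_axioms.intro HG.group_axioms U.group_axioms magnus_first_hom)

text \<open>The presentation says nothing about the first coordinate. A choice of preimages in \<open>H\<^sub>r\<close> of the
  generators gives every word a first coordinate; for null-homotopic words it lies in the kernel
  of the projection.\<close>

definition lift :: "'x \<Rightarrow> nat \<Rightarrow> gen word" where
  "lift x = (SOME h. h \<in> H \<and> projection_from_2 r h = \<phi> x)"

lemma lift:
  assumes "x \<in> X"
  shows "lift x \<in> H" "projection_from_2 r (lift x) = \<phi> x"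
proof -
  have "\<phi> x \<in> projection_from_2 r ` H"
    using funcset_mem[OF \<phi>_carrier assms] by (simp add: G2_group_def)
  then have "\<exists>h. h \<in> H \<and> projection_from_2 r h = \<phi> x" by (elim imageE) (intro exI conjI; simp)
  from someI_ex[OF this] show "lift x \<in> H" "projection_from_2 r (lift x) = \<phi> x"
    by (simp_all add: lift_def)
qed

lemma lift_carrier: "lift \<in> X \<rightarrow> carrier HG"
  using lift by auto

definition first_gen :: "'x \<Rightarrow> matrix" where
  "first_gen x = magnus (lift x 1)"

lemma first_gen_carrier: "first_gen \<in> X \<rightarrow> carrier U"
  using first.hom_closed lift_carrier unfolding first_gen_def by blast

lemma word_lift:
  assumes "w \<in> words X"
  shows "word_eval HG lift w \<in> carrier HG"
    and "projection_from_2 r (word_eval HG lift w) = word_eval G \<phi> w"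
    and "magnus (word_eval HG lift w 1) = word_eval U first_gen w"
proof -
  show "word_eval HG lift w \<in> carrier HG"
    by (rule HG.word_eval_closed[OF lift_carrier assms])
  show "projection_from_2 r (word_eval HG lift w) = word_eval G \<phi> w"
    by (rule hom_word_eval[OF HG.group_axioms G.group_axioms projection_hom lift_carrier _ assms])
      (rule lift(2))
  show "magnus (word_eval HG lift w 1) = word_eval U first_gen w"
    by (rule hom_word_eval[OF HG.group_axioms U.group_axioms magnus_first_hom lift_carrier _ assms])
      (simp add: first_gen_def)
qed

lemma kernel_first_gap:
  assumes h: "h \<in> carrier HG" and kernel: "projection_from_2 r h = \<one>\<^bsub>G\<^esub>"
  shows "magnus (h 1) \<in> gap (r - 1)"
proof (rule poly_coordinates_first_gap)
  show "poly_coordinates r (r - 1) h" using H_poly_coordinates h by simp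
  fix t assume t: "t \<in> {2..r}"
  from kernel have "restrict h {2..r} t = \<one>\<^bsub>F2_product {2..r}\<^esub> t"
    by (simp add: projection_from_2_def G2_group_def)
  with t show "h t = \<one>\<^bsub>F2\<^esub>" by simp
qed (use r in simp)

lemma null_homotopic_first_gap:
  assumes "null_homotopic G X \<phi> w"
  shows "word_eval U first_gen w \<in> gap (r - 1)"
proof -
  have w: "w \<in> words X" "word_eval G \<phi> w = \<one>\<^bsub>G\<^esub>"
    using assms by (auto simp: null_homotopic_def)
  have "projection_from_2 r (word_eval HG lift w) = \<one>\<^bsub>G\<^esub>"
    unfolding word_lift(2)[OF w(1)] by (rule w(2))
  from kernel_first_gap[OF word_lift(1)[OF w(1)] this] show ?thesis
    unfolding word_lift(3)[OF w(1)] .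
qed

text \<open>Dividing the \<open>t\<close>-th power of a diagonal element by \<open>z\<^sub>3\<close> or \<open>z\<^sub>4\<close> trivialises coordinate \<open>t\<close>. In
  \<open>coordinate_killer k\<close> this is coordinate \<open>k + 2\<close>, and the first coordinate is \<open>a\<close> or \<open>b\<^sup>k\<^sup>+\<^sup>1\<close>.\<close>

definition coordinate_killer :: "nat \<Rightarrow> nat \<Rightarrow> gen word" where
  "coordinate_killer k = (if k = 0 then z1 r [^]\<^bsub>HG\<^esub> (k + 2) \<otimes>\<^bsub>HG\<^esub> inv\<^bsub>HG\<^esub> z3 r
     else z2 r [^]\<^bsub>HG\<^esub> (k + 2) \<otimes>\<^bsub>HG\<^esub> inv\<^bsub>HG\<^esub> z4 r)"

lemma z_H: "z1 r \<in> H" "z2 r \<in> H" "z3 r \<in> H" "z4 r \<in> H"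
  unfolding H_subgroup_def by (auto intro: generate.incl)

lemma coordinate_killer_carrier: "coordinate_killer k \<in> carrier HG"
proof -
  have z: "z1 r \<in> carrier HG" "z2 r \<in> carrier HG" "z3 r \<in> carrier HG" "z4 r \<in> carrier HG"
    using z_H by simp_all
  show ?thesis unfolding coordinate_killer_def
    by (split if_split) (intro conjI impI HG.m_closed HG.nat_pow_closed HG.inv_closed z)
qed

lemma coordinate_killer_coord:
  assumes t: "t \<in> {1..r}"
  shows "coordinate_killer k t = (let g = [(if k = 0 then Gen_a else Gen_b, True)] in
    g [^]\<^bsub>F2\<^esub> (k + 2) \<otimes>\<^bsub>F2\<^esub> inv\<^bsub>F2\<^esub> (g [^]\<^bsub>F2\<^esub> t))"
proof -
  interpret coord: group_hom HG F2 "\<lambda>h. h t"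
    by (intro group_hom.intro group_hom_axioms.intro HG.group_axioms F2.group_axioms coord_hom[OF t])
  have eval: "(x [^]\<^bsub>HG\<^esub> m \<otimes>\<^bsub>HG\<^esub> inv\<^bsub>HG\<^esub> y) t = x t [^]\<^bsub>F2\<^esub> m \<otimes>\<^bsub>F2\<^esub> inv\<^bsub>F2\<^esub> (y t)"
    if "x \<in> H" "y \<in> H" for x y and m :: nat
  proof -
    have xy: "x \<in> carrier HG" "y \<in> carrier HG" using that by simp_all
    show ?thesis
      using coord.hom_mult[OF HG.nat_pow_closed[OF xy(1), of m] HG.inv_closed[OF xy(2)]]
        coord.hom_nat_pow[OF xy(1), of m] coord.hom_inv[OF xy(2)] by (simp only:)
  qed
  show ?thesis
    unfolding coordinate_killer_def
    by (auto simp only: eval z_H if_True if_False Let_def split: if_split)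
      (use t in \<open>simp_all only: z1_def z2_def z3_def z4_def F2_a_def F2_b_def restrict_apply' if_True if_False simp_thms\<close>)
qed

lemma coordinate_killer_trivial: "k + 2 \<le> r \<Longrightarrow> coordinate_killer k (k + 2) = \<one>\<^bsub>F2\<^esub>"
  by (subst coordinate_killer_coord) (auto simp only: Let_def F2.r_inv F2.nat_pow_closed letter_F2 atLeastAtMost_iff)

lemma coordinate_killer_first:
  "magnus (coordinate_killer k 1) i (Suc i) = (if k = 0 \<longleftrightarrow> i = 0 then int (k + 1) else 0)"
proof -
  let ?g = "if k = 0 then Gen_a else Gen_b"
  have one: "1 \<in> {1..r}" using r by simp
  have "magnus (coordinate_killer k 1)
      = magnus_gen ?g [^]\<^bsub>U\<^esub> (k + 2) \<otimes>\<^bsub>U\<^esub> inv\<^bsub>U\<^esub> (magnus_gen ?g [^]\<^bsub>U\<^esub> (1::nat))"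
    unfolding coordinate_killer_coord[OF one] Let_def
    by (simp only: magnus.hom_mult magnus.hom_nat_pow magnus.hom_inv F2.nat_pow_closed F2.inv_closed
        letter_F2 magnus_letter)
  then have "magnus (coordinate_killer k 1) i (Suc i)
      = int (k + 2) * magnus_gen ?g i (Suc i) - magnus_gen ?g i (Suc i)"
    by (simp only: first_superdiagonal_mult first_superdiagonal_inv first_superdiagonal_pow
        U.nat_pow_closed U.inv_closed magnus_gen_carrier)
  then show ?thesis by (simp add: magnus_gen_def algebra_simps)
qed

text \<open>Two elements of \<open>H\<^sub>r\<close> with the same projection have first coordinates with the same first superdiagonal,
  because \<open>r \<ge> 3\<close> puts the kernel into the second term of the filtration. So words that represent the images
  of the \<open>coordinate_killer k\<close> inherit its first superdiagonal.\<close>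

lemma killer_word_exists:
  "\<exists>u\<in>words X. word_eval G \<phi> u = projection_from_2 r (coordinate_killer k) \<and>
     (\<forall>i. word_eval U first_gen u i (Suc i) = magnus (coordinate_killer k 1) i (Suc i))"
proof -
  let ?c = "coordinate_killer k"
  have c: "?c \<in> carrier HG" by (rule coordinate_killer_carrier)
  have "word_eval G \<phi> ` carrier (free_group X) = carrier G"
    using pres by (simp add: finite_presentation_def epi_def)
  then obtain u where "u \<in> carrier (free_group X)" and eval: "word_eval G \<phi> u = projection_from_2 r ?c"
    using projection.hom_closed[OF c] by (metis imageE)
  then have u: "u \<in> words X" by (simp add: free_group_def)
  let ?h = "word_eval HG lift u"
  let ?q = "?h \<otimes>\<^bsub>HG\<^esub> inv\<^bsub>HG\<^esub> ?c"
  have h: "?h \<in> carrier HG" by (rule word_lift(1)[OF u])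
  have q: "?q \<in> carrier HG" using h c by (intro HG.m_closed HG.inv_closed)
  have "projection_from_2 r ?q = \<one>\<^bsub>G\<^esub>"
    using projection.hom_mult[OF h HG.inv_closed[OF c]] projection.hom_inv[OF c]
      G.r_inv[OF projection.hom_closed[OF c]]
    by (simp only: word_lift(2)[OF u] eval)
  note kernel_first_gap[OF q this]
  moreover have "gap (r - 1) \<subseteq> gap 2" by (rule gap_antimono) (use r in simp)
  ultimately have "magnus (?q 1) \<in> gap 2" by (rule rev_subsetD)
  then have zero: "magnus (?q 1) i (Suc i) = 0" for i
    using gap_zero[of "magnus (?q 1)" 2 1 i] by simp
  have first_c: "magnus (?c 1) \<in> carrier U" by (rule first.hom_closed[OF c])
  have first_u: "word_eval U first_gen u \<in> carrier U" by (rule U.word_eval_closed[OF first_gen_carrier u])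
  have "magnus (?q 1) = word_eval U first_gen u \<otimes>\<^bsub>U\<^esub> inv\<^bsub>U\<^esub> magnus (?c 1)"
    using first.hom_mult[OF h HG.inv_closed[OF c]] first.hom_inv[OF c]
    by (simp only: word_lift(3)[OF u])
  with zero have "word_eval U first_gen u i (Suc i) = magnus (?c 1) i (Suc i)" for i
    using first_superdiagonal_mult[OF first_u U.inv_closed[OF first_c], of i]
      first_superdiagonal_inv[OF first_c, of i] by (metis add.right_inverse add_right_cancel)
  with u eval show ?thesis by blast
qed

definition killer_word :: "nat \<Rightarrow> 'x word" where
  "killer_word k = (SOME u. u \<in> words X \<and> word_eval G \<phi> u = projection_from_2 r (coordinate_killer k) \<and>
     (\<forall>i. word_eval U first_gen u i (Suc i) = magnus (coordinate_killer k 1) i (Suc i)))"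

lemma killer_word:
  "killer_word k \<in> words X"
  "word_eval G \<phi> (killer_word k) = projection_from_2 r (coordinate_killer k)"
  "word_eval U first_gen (killer_word k) i (Suc i) = (if k = 0 \<longleftrightarrow> i = 0 then int (k + 1) else 0)"
proof -
  have "killer_word k \<in> words X \<and> word_eval G \<phi> (killer_word k) = projection_from_2 r (coordinate_killer k) \<and>
     (\<forall>i. word_eval U first_gen (killer_word k) i (Suc i) = magnus (coordinate_killer k 1) i (Suc i))"
    unfolding killer_word_def by (rule someI_ex) (use killer_word_exists in blast)
  then show "killer_word k \<in> words X"
    "word_eval G \<phi> (killer_word k) = projection_from_2 r (coordinate_killer k)"
    "word_eval U first_gen (killer_word k) i (Suc i) = (if k = 0 \<longleftrightarrow> i = 0 then int (k + 1) else 0)"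
    using coordinate_killer_first by simp_all
qed

abbreviation (input) "test_word n \<equiv> iterated_commutator killer_word n (r - 2)"

text \<open>Every coordinate from 2 to \<open>r\<close> is trivial in one of the entries of the commutator.\<close>

lemma test_word_null_homotopic: "null_homotopic G X \<phi> (test_word n)"
proof -
  have w: "test_word n \<in> words X" by (rule iterated_commutator_words) (rule killer_word(1))
  let ?g = "word_eval G \<phi> (test_word n)"
  have g: "?g \<in> carrier G" by (rule G.word_eval_closed[OF \<phi>_carrier w])
  have "?g t = \<one>\<^bsub>F2\<^esub>" if t: "t \<in> {2..r}" for t
  proof -
    have t1: "t \<in> {1..r}" using t by auto
    have hom: "(\<lambda>g. g t) \<in> hom G F2"
    proof (rule homI)
      fix g assume "g \<in> carrier G"
      then obtain h where "h \<in> carrier HG" "g = projection_from_2 r h" by (auto simp: G2_group_def)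
      moreover have "h t \<in> carrier F2" using hom_in_carrier[OF coord_hom[OF t1]] \<open>h \<in> carrier HG\<close> .
      ultimately show "g t \<in> carrier F2" using t by (simp add: projection_from_2_def)
    qed (use t in \<open>simp add: G2_group_def\<close>)
    let ?\<phi>t = "\<lambda>x. \<phi> x t"
    have \<phi>t: "?\<phi>t \<in> X \<rightarrow> carrier F2" using \<phi>_carrier hom_in_carrier[OF hom] by blast
    have coord: "word_eval F2 ?\<phi>t v = word_eval G \<phi> v t" if "v \<in> words X" for v
      by (rule hom_word_eval[OF G.group_axioms F2.group_axioms hom \<phi>_carrier refl that, symmetric])
    define j where "j = t - 2"
    have j: "j + 2 = t" "j \<le> r - 2" using t by (auto simp: j_def)
    have "word_eval F2 ?\<phi>t (killer_word j) = coordinate_killer j t"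
      using t by (simp add: coord killer_word projection_from_2_def)
    also have "\<dots> = \<one>\<^bsub>F2\<^esub>" using coordinate_killer_trivial[of j] j t by simp
    finally have "word_eval F2 ?\<phi>t (test_word n) = \<one>\<^bsub>F2\<^esub>"
      using F2.word_eval_iterated_commutator_trivial[where u = killer_word, OF \<phi>t killer_word(1) _ j(2)] by blast
    then show ?thesis using coord[OF w] by simp
  qed
  moreover have "?g \<in> extensional {2..r}" "\<one>\<^bsub>G\<^esub> \<in> extensional {2..r}"
    using g by (auto simp: G2_group_def projection_from_2_def)
  ultimately have "?g = \<one>\<^bsub>G\<^esub>"
    by (intro extensionalityI[of _ "{2..r}"]) (auto simp: G2_group_def)
  then show ?thesis using w by (simp add: null_homotopic_def)
qed

lemma test_word_entry: "word_eval U first_gen (test_word n) 0 (r - 1) = fact (r - 1) * int n ^ (r - 1)"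
proof -
  have "word_eval U first_gen (test_word n) 0 (Suc (r - 2)) = fact (Suc (r - 2)) * int n ^ Suc (r - 2)"
    using iterated_commutator_leading_entry[OF first_gen_carrier killer_word(1), where m = "r - 2" and k = "r - 2" and n = n]
      killer_word(3)[of _ 0] killer_word(3) by simp
  moreover have "Suc (r - 2) = r - 1" using r by simp
  ultimately show ?thesis by simp
qed

lemma area_le_dehn_function:
  assumes "null_homotopic G X \<phi> w" "length w \<le> n"
  shows "area X R w \<le> dehn_function G X R \<phi> n"
proof -
  have "finite (X \<times> (UNIV :: bool set))" using pres by (simp add: finite_presentation_def)
  from finite_lists_length_le[OF this, of n]
  have "finite {w. null_homotopic G X \<phi> w \<and> length w \<le> n}"
    by (rule rev_finite_subset) (auto simp: null_homotopic_def words_def)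
  then show ?thesis unfolding dehn_function_def using assms by (intro Max_ge) auto
qed

lemma dehn_function_lower_bound:
  "(\<lambda>n. real (n ^ (r - 1))) \<preceq>\<^sub>D (\<lambda>n. real (dehn_function G X R \<phi> n))"
proof -
  have r1: "0 < r - 1" using r by simp
  obtain B where B: "\<And>w. null_homotopic G X \<phi> w \<Longrightarrow>
      word_eval U first_gen w 0 (r - 1) \<le> int B * int (area X R w)"
  proof (rule area_lower_bound[OF pres U.group_axioms first_gen_carrier])
    show "word_eval U first_gen w \<in> gap (r - 1)" if "null_homotopic G X \<phi> w" for w
      by (rule null_homotopic_first_gap[OF that])
    show "(M \<otimes>\<^bsub>U\<^esub> N) 0 (r - 1) = M 0 (r - 1) + N 0 (r - 1)"
      if "M \<in> gap (r - 1)" "N \<in> gap (r - 1)" for M N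
      using gap_mult_below[OF that r1 r1 r1, of 0] r1 by simp
    show "(M \<otimes>\<^bsub>U\<^esub> N \<otimes>\<^bsub>U\<^esub> inv\<^bsub>U\<^esub> M) 0 (r - 1) = N 0 (r - 1)"
      if "M \<in> carrier U" "N \<in> gap (r - 1)" for M N
      using gap_conj_entry[OF that r1, of 0] by simp
  qed blast
  obtain L where L: "\<And>n. length (test_word n) \<le> L * n"
    using length_iterated_commutator by blast
  define C where "C = max 1 (max B L)"
  have "n ^ (r - 1) \<le> C * dehn_function G X R \<phi> (C * n)" for n
  proof -
    have "int (n ^ (r - 1)) \<le> fact (r - 1) * int n ^ (r - 1)"
      using mult_right_mono[of 1 "fact (r - 1) :: int" "int n ^ (r - 1)"] fact_ge_1 by simp
    also have "\<dots> \<le> int (B * area X R (test_word n))"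
      using B[OF test_word_null_homotopic, of n] by (simp only: test_word_entry of_nat_mult)
    finally have "n ^ (r - 1) \<le> B * area X R (test_word n)" by linarith
    also have "\<dots> \<le> C * dehn_function G X R \<phi> (C * n)"
    proof (rule mult_mono)
      have "L \<le> C" by (simp add: C_def)
      then have "length (test_word n) \<le> C * n"
        by (rule order_trans[OF L mult_le_mono1])
      then show "area X R (test_word n) \<le> dehn_function G X R \<phi> (C * n)"
        by (rule area_le_dehn_function[OF test_word_null_homotopic])
    qed (auto simp: C_def)
    finally show ?thesis .
  qed
  then have "real (n ^ (r - 1)) \<le> real C * real (dehn_function G X R \<phi> (C * n)) + real C * real n + real C" for n
    by (smt (verit) of_nat_0_le_iff of_nat_le_iff of_nat_mult mult_nonneg_nonneg)
  moreover have "1 \<le> C" by (simp add: C_def)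
  ultimately show ?thesis unfolding dehn_preceq_def by blast
qed

end

theorem theorem4p2:
  fixes r :: nat
    and Y :: "nat \<Rightarrow> gen word set"
    and X :: "'x set"
    and R :: "'x word set"
    and \<phi> :: "'x \<Rightarrow> (nat \<Rightarrow> gen word)"
  assumes "r \<ge> 3"
    and "admissible_Y r Y"
    and "finite_presentation (G2_group r Y) X R \<phi>"
  shows "(\<lambda>n. real (n ^ (r - 1))) \<preceq>\<^sub>D (\<lambda>n. real (dehn_function (G2_group r Y) X R \<phi> n))"
  using assms by (rule dehn_function_lower_bound)

end
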